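(* Let $(M,J,g)$ be a $2n$-dimensional conformal Kähler manifold with Norden metric, let $p,q\in\mathbb{R}$ be arbitrary, and let $\nabla'$ be the complex connection $$\nabla'_XY=\nabla_XY+\tfrac12(\nabla_XJ)JY+p\{(\nabla_YJ)X+(\nabla_{JY}J)JX\}+q\{(\nabla_YJ)JX-(\nabla_{JY}J)X\}.$$ Then the curvature tensor $R'$ of $\nabla'$ (viewed as a $(0,4)$-tensor) is a Kähler tensor and has the form $$R'=R-\frac{1}{4n}\{\psi_1+\psi_2\}(S)-\frac{1}{8n^2}\psi_1(P)-\frac{\theta(\Omega)}{16n^2}\{3\pi_1+\pi_2\}+\frac{\theta(J\Omega)}{16n^2}\pi_3,$$ where $$S(X,Y)=(\nabla_X\theta)JY+\frac{1}{4n}\{\theta(X)\theta(Y)-\theta(JX)\theta(JY)\},\qquad P(X,Y)=\theta(X)\theta(Y)+\theta(JX)\theta(JY).$$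
   Context: An almost complex manifold with Norden metric $(M,J,g)$ is a $2n$-dimensional smooth manifold with an almost complex structure $J$ ($J^2X=-X$) and a pseudo-Riemannian metric $g$ such that $g(JX,JY)=-g(X,Y)$. $\nabla$ is the Levi-Civita connection of $g$, $F(X,Y,Z)=g((\nabla_XJ)Y,Z)$, and $\widetilde g(X,Y)=g(X,JY)$. With $\{e_i\}$ a basis of $T_pM$ and $(g^{ij})$ the inverse matrix of $g$, the Lie 1-forms are $\theta(z)=g^{ij}F(e_i,e_j,z)$ and $\theta^*=\theta\circ J$, and the Lie vector $\Omega$ is defined by $\theta(z)=g(z,\Omega)$. $(M,J,g)$ is a $\mathcal W_1$-manifold if $$F(X,Y,Z)=\tfrac{1}{2n}[g(X,Y)\theta(Z)+g(X,JY)\theta(JZ)+g(X,Z)\theta(Y)+g(X,JZ)\theta(JY)];$$ it is a conformal Kähler manifold with Norden metric if it is a $\mathcal W_1$-manifold and both $\theta$ and $\theta^*$ are closed. $R$ is the curvature tensor of $\nabla$: $R(X,Y)Z=\nabla_X\nabla_YZ-\nabla_Y\nabla_XZ-\nabla_{[X,Y]}Z$, $R(X,Y,Z,W)=g(R(X,Y)Z,W)$; $R'$ is defined in the same way from $\nabla'$, also using $g$ to lower the index. A $(0,4)$-tensor $L$ is curvature-like if $L(X,Y,Z,W)=-L(Y,X,Z,W)=-L(X,Y,W,Z)$ and $L(X,Y,Z,W)+L(Y,Z,X,W)+L(Z,X,Y,W)=0$; a curvature-like $L$ is a Kähler tensor if $L(X,Y,JZ,JW)=-L(X,Y,Z,W)$.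 For a $(0,2)$-tensor $S$, $$\psi_1(S)(X,Y,Z,W)=g(Y,Z)S(X,W)-g(X,Z)S(Y,W)+g(X,W)S(Y,Z)-g(Y,W)S(X,Z),$$ $$\psi_2(S)(X,Y,Z,W)=g(Y,JZ)S(X,JW)-g(X,JZ)S(Y,JW)+g(X,JW)S(Y,JZ)-g(Y,JW)S(X,JZ),$$ $\pi_1=\tfrac12\psi_1(g)$, $\pi_2=\tfrac12\psi_2(g)$, $\pi_3=-\psi_1(\widetilde g)=\psi_2(\widetilde g)$. A connection is called complex if $\nabla'J=0$ (here $J$ is integrable). *)

theory Defs
  imports "HOL-Analysis.Analysis" "HOL-Library.Function_Algebras"
begin

section \<open>Smooth manifolds\<close>

text \<open>\<open>f\<close> is \<open>k\<close> times continuously differentiable on \<open>U\<close>. Only meaningful for open \<open>U\<close>: the derivative is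
  the one at an interior point.\<close>

primrec Ck_on :: "nat \<Rightarrow> ('a::real_normed_vector \<Rightarrow> 'b::real_normed_vector) \<Rightarrow> 'a set \<Rightarrow> bool" where
  "Ck_on 0 f U \<longleftrightarrow> continuous_on U f"
| "Ck_on (Suc k) f U \<longleftrightarrow>
     f differentiable_on U \<and> (\<forall>v. Ck_on k (\<lambda>x. frechet_derivative f (at x) v) U)"

definition smooth_on :: "('a::real_normed_vector \<Rightarrow> 'b::real_normed_vector) \<Rightarrow> 'a set \<Rightarrow> bool" where
  "smooth_on f U \<longleftrightarrow> (\<forall>k. Ck_on k f U)"

text \<open>The manifold is the whole type \<open>'m\<close>, modelled on the Euclidean space \<open>'e\<close>; a chart is a pair
  of a domain and a coordinate map, whose values outside the domain are irrelevant.\<close>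

type_synonym ('m, 'e) atlas = "('m set \<times> ('m \<Rightarrow> 'e)) set"

definition smooth_atlas ::
    "('m::{t2_space,second_countable_topology}, 'e::euclidean_space) atlas \<Rightarrow> bool" where
  "smooth_atlas A \<longleftrightarrow>
     (\<Union>(U, \<phi>)\<in>A. U) = UNIV \<and>
     (\<forall>(U, \<phi>)\<in>A. open U \<and> open (\<phi> ` U) \<and> (\<exists>\<psi>. homeomorphism U (\<phi> ` U) \<phi> \<psi>)) \<and>
     (\<forall>(U, \<phi>)\<in>A. \<forall>(V, \<kappa>)\<in>A. smooth_on (\<kappa> \<circ> inv_into U \<phi>) (\<phi> ` (U \<inter> V)))"

definition Cinf :: "('m, 'e::euclidean_space) atlas \<Rightarrow> ('m \<Rightarrow> real) set" where
  "Cinf A = {f. \<forall>(U, \<phi>)\<in>A. smooth_on (f \<circ> inv_into U \<phi>) (\<phi> ` U)}"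

text \<open>Tangent vectors at \<open>x\<close> are the derivations at \<open>x\<close> of the algebra of smooth functions. They are
  set to 0 on non-smooth functions, so that equality of tangent vectors is equality in HOL.\<close>

type_synonym 'm tvec = "('m \<Rightarrow> real) \<Rightarrow> real"

definition tangent_space :: "('m, 'e::euclidean_space) atlas \<Rightarrow> 'm \<Rightarrow> 'm tvec set" where
  "tangent_space A x = {v.
     (\<forall>f\<in>Cinf A. \<forall>h\<in>Cinf A. v (f + h) = v f + v h) \<and>
     (\<forall>c. \<forall>f\<in>Cinf A. v (\<lambda>y. c * f y) = c * v f) \<and>
     (\<forall>f\<in>Cinf A. \<forall>h\<in>Cinf A. v (f * h) = v f * h x + f x * v h) \<and>
     (\<forall>f. f \<notin> Cinf A \<longrightarrow> v f = 0)}"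

type_synonym 'm vfield = "'m \<Rightarrow> 'm tvec"

definition act :: "'m vfield \<Rightarrow> ('m \<Rightarrow> real) \<Rightarrow> 'm \<Rightarrow> real" where
  "act X f = (\<lambda>x. X x f)"

definition vfields :: "('m, 'e::euclidean_space) atlas \<Rightarrow> 'm vfield set" where
  "vfields A = {X. (\<forall>x. X x \<in> tangent_space A x) \<and> (\<forall>f\<in>Cinf A. act X f \<in> Cinf A)}"

definition fscale :: "('m \<Rightarrow> real) \<Rightarrow> 'm vfield \<Rightarrow> 'm vfield" (infixr \<open>\<odot>\<close> 75) where
  "f \<odot> X = (\<lambda>x h. f x * X x h)"

definition rscale :: "real \<Rightarrow> 'm vfield \<Rightarrow> 'm vfield" (infixr \<open>\<cdot>\<^sub>R\<close> 75) where
  "c \<cdot>\<^sub>R X = (\<lambda>x h. c * X x h)"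

definition lie_bracket :: "'m vfield \<Rightarrow> 'm vfield \<Rightarrow> 'm vfield" where
  "lie_bracket X Y = (\<lambda>x f. X x (act Y f) - Y x (act X f))"

section \<open>Tensor fields\<close>

text \<open>Tensor fields are maps that are multilinear over the smooth functions, defined on smooth vector
  fields. Their values outside \<open>vfields A\<close> are irrelevant.\<close>

definition one_form :: "('m, 'e::euclidean_space) atlas \<Rightarrow> ('m vfield \<Rightarrow> 'm \<Rightarrow> real) \<Rightarrow> bool" where
  "one_form A \<omega> \<longleftrightarrow>
     (\<forall>X\<in>vfields A. \<omega> X \<in> Cinf A) \<and>
     (\<forall>X\<in>vfields A. \<forall>Y\<in>vfields A. \<omega> (X + Y) = \<omega> X + \<omega> Y) \<and>
     (\<forall>f\<in>Cinf A. \<forall>X\<in>vfields A. \<omega> (f \<odot> X) = f * \<omega> X)"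

definition tensor02 ::
    "('m, 'e::euclidean_space) atlas \<Rightarrow> ('m vfield \<Rightarrow> 'm vfield \<Rightarrow> 'm \<Rightarrow> real) \<Rightarrow> bool" where
  "tensor02 A T \<longleftrightarrow> (\<forall>X\<in>vfields A. one_form A (\<lambda>Y. T X Y) \<and> one_form A (\<lambda>Y. T Y X))"

definition tensor04 ::
    "('m, 'e::euclidean_space) atlas \<Rightarrow>
     ('m vfield \<Rightarrow> 'm vfield \<Rightarrow> 'm vfield \<Rightarrow> 'm vfield \<Rightarrow> 'm \<Rightarrow> real) \<Rightarrow> bool" where
  "tensor04 A L \<longleftrightarrow> (\<forall>X\<in>vfields A. \<forall>Y\<in>vfields A. \<forall>Z\<in>vfields A.
     one_form A (\<lambda>V. L V X Y Z) \<and> one_form A (\<lambda>V. L X V Y Z) \<and>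
     one_form A (\<lambda>V. L X Y V Z) \<and> one_form A (\<lambda>V. L X Y Z V))"

definition tensor11 :: "('m, 'e::euclidean_space) atlas \<Rightarrow> ('m vfield \<Rightarrow> 'm vfield) \<Rightarrow> bool" where
  "tensor11 A J \<longleftrightarrow>
     (\<forall>X\<in>vfields A. J X \<in> vfields A) \<and>
     (\<forall>X\<in>vfields A. \<forall>Y\<in>vfields A. J (X + Y) = J X + J Y) \<and>
     (\<forall>f\<in>Cinf A. \<forall>X\<in>vfields A. J (f \<odot> X) = f \<odot> J X)"

text \<open>The last conjunct is nondegeneracy at every point: the values at \<open>x\<close> of smooth vector fields
  exhaust the tangent space at \<open>x\<close>.\<close>

definition pseudo_riemannian ::
    "('m, 'e::euclidean_space) atlas \<Rightarrow> ('m vfield \<Rightarrow> 'm vfield \<Rightarrow> 'm \<Rightarrow> real) \<Rightarrow> bool" where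
  "pseudo_riemannian A g \<longleftrightarrow>
     tensor02 A g \<and>
     (\<forall>X\<in>vfields A. \<forall>Y\<in>vfields A. g X Y = g Y X) \<and>
     (\<forall>x. \<forall>X\<in>vfields A. (\<forall>Y\<in>vfields A. g X Y x = 0) \<longrightarrow> X x = 0)"

definition closed_one_form ::
    "('m, 'e::euclidean_space) atlas \<Rightarrow> ('m vfield \<Rightarrow> 'm \<Rightarrow> real) \<Rightarrow> bool" where
  "closed_one_form A \<omega> \<longleftrightarrow>
     one_form A \<omega> \<and>
     (\<forall>X\<in>vfields A. \<forall>Y\<in>vfields A. act X (\<omega> Y) - act Y (\<omega> X) - \<omega> (lie_bracket X Y) = 0)"

section \<open>Connections\<close>

definition affine_connection ::
    "('m, 'e::euclidean_space) atlas \<Rightarrow> ('m vfield \<Rightarrow> 'm vfield \<Rightarrow> 'm vfield) \<Rightarrow> bool" where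
  "affine_connection A D \<longleftrightarrow>
     (\<forall>X\<in>vfields A. \<forall>Y\<in>vfields A. D X Y \<in> vfields A) \<and>
     (\<forall>X\<in>vfields A. \<forall>Y\<in>vfields A. \<forall>Z\<in>vfields A. D (X + Y) Z = D X Z + D Y Z) \<and>
     (\<forall>f\<in>Cinf A. \<forall>X\<in>vfields A. \<forall>Y\<in>vfields A. D (f \<odot> X) Y = f \<odot> D X Y) \<and>
     (\<forall>X\<in>vfields A. \<forall>Y\<in>vfields A. \<forall>Z\<in>vfields A. D X (Y + Z) = D X Y + D X Z) \<and>
     (\<forall>f\<in>Cinf A. \<forall>X\<in>vfields A. \<forall>Y\<in>vfields A. D X (f \<odot> Y) = act X f \<odot> Y + f \<odot> D X Y)"

definition levi_civita ::
    "('m, 'e::euclidean_space) atlas \<Rightarrow> ('m vfield \<Rightarrow> 'm vfield \<Rightarrow> 'm \<Rightarrow> real) \<Rightarrow>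
     ('m vfield \<Rightarrow> 'm vfield \<Rightarrow> 'm vfield) \<Rightarrow> bool" where
  "levi_civita A g D \<longleftrightarrow>
     affine_connection A D \<and>
     (\<forall>X\<in>vfields A. \<forall>Y\<in>vfields A. D X Y - D Y X = lie_bracket X Y) \<and>
     (\<forall>X\<in>vfields A. \<forall>Y\<in>vfields A. \<forall>Z\<in>vfields A.
        act X (g Y Z) = g (D X Y) Z + g Y (D X Z))"

text \<open>\<open>cov_J D J X Y\<close> is \<open>(D\<^sub>X J) Y\<close> and \<open>cov_form D \<omega> X Y\<close> is \<open>(D\<^sub>X \<omega>) Y\<close>.\<close>

definition cov_J ::
    "('m vfield \<Rightarrow> 'm vfield \<Rightarrow> 'm vfield) \<Rightarrow> ('m vfield \<Rightarrow> 'm vfield) \<Rightarrow>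
     'm vfield \<Rightarrow> 'm vfield \<Rightarrow> 'm vfield" where
  "cov_J D J X Y = D X (J Y) - J (D X Y)"

definition cov_form ::
    "('m vfield \<Rightarrow> 'm vfield \<Rightarrow> 'm vfield) \<Rightarrow> ('m vfield \<Rightarrow> 'm \<Rightarrow> real) \<Rightarrow>
     'm vfield \<Rightarrow> 'm vfield \<Rightarrow> 'm \<Rightarrow> real" where
  "cov_form D \<omega> X Y = act X (\<omega> Y) - \<omega> (D X Y)"

definition curvature ::
    "('m vfield \<Rightarrow> 'm vfield \<Rightarrow> 'm vfield) \<Rightarrow> 'm vfield \<Rightarrow> 'm vfield \<Rightarrow> 'm vfield \<Rightarrow> 'm vfield" where
  "curvature D X Y Z = D X (D Y Z) - D Y (D X Z) - D (lie_bracket X Y) Z"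

definition curvature04 ::
    "('m vfield \<Rightarrow> 'm vfield \<Rightarrow> 'm \<Rightarrow> real) \<Rightarrow> ('m vfield \<Rightarrow> 'm vfield \<Rightarrow> 'm vfield) \<Rightarrow>
     'm vfield \<Rightarrow> 'm vfield \<Rightarrow> 'm vfield \<Rightarrow> 'm vfield \<Rightarrow> 'm \<Rightarrow> real" where
  "curvature04 g D X Y Z W = g (curvature D X Y Z) W"

definition curvature_like ::
    "('m, 'e::euclidean_space) atlas \<Rightarrow>
     ('m vfield \<Rightarrow> 'm vfield \<Rightarrow> 'm vfield \<Rightarrow> 'm vfield \<Rightarrow> 'm \<Rightarrow> real) \<Rightarrow> bool" where
  "curvature_like A L \<longleftrightarrow>
     tensor04 A L \<and>
     (\<forall>X\<in>vfields A. \<forall>Y\<in>vfields A. \<forall>Z\<in>vfields A. \<forall>W\<in>vfields A.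
        L X Y Z W = - L Y X Z W \<and>
        L X Y Z W = - L X Y W Z \<and>
        L X Y Z W + L Y Z X W + L Z X Y W = 0)"

definition kahler_tensor ::
    "('m, 'e::euclidean_space) atlas \<Rightarrow> ('m vfield \<Rightarrow> 'm vfield) \<Rightarrow>
     ('m vfield \<Rightarrow> 'm vfield \<Rightarrow> 'm vfield \<Rightarrow> 'm vfield \<Rightarrow> 'm \<Rightarrow> real) \<Rightarrow> bool" where
  "kahler_tensor A J L \<longleftrightarrow>
     curvature_like A L \<and>
     (\<forall>X\<in>vfields A. \<forall>Y\<in>vfields A. \<forall>Z\<in>vfields A. \<forall>W\<in>vfields A.
        L X Y (J Z) (J W) = - L X Y Z W)"

section \<open>Almost complex manifolds with Norden metric\<close>

definition norden_manifold ::
    "('m::{t2_space,second_countable_topology}, 'e::euclidean_space) atlas \<Rightarrow> nat \<Rightarrow>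
     ('m vfield \<Rightarrow> 'm vfield) \<Rightarrow> ('m vfield \<Rightarrow> 'm vfield \<Rightarrow> 'm \<Rightarrow> real) \<Rightarrow> bool" where
  "norden_manifold A n J g \<longleftrightarrow>
     smooth_atlas A \<and> DIM('e) = 2 * n \<and>
     tensor11 A J \<and> (\<forall>X\<in>vfields A. J (J X) = - X) \<and>
     pseudo_riemannian A g \<and>
     (\<forall>X\<in>vfields A. \<forall>Y\<in>vfields A. g (J X) (J Y) = - g X Y)"

definition F_tensor ::
    "('m vfield \<Rightarrow> 'm vfield) \<Rightarrow> ('m vfield \<Rightarrow> 'm vfield \<Rightarrow> 'm \<Rightarrow> real) \<Rightarrow>
     ('m vfield \<Rightarrow> 'm vfield \<Rightarrow> 'm vfield) \<Rightarrow>
     'm vfield \<Rightarrow> 'm vfield \<Rightarrow> 'm vfield \<Rightarrow> 'm \<Rightarrow> real" where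
  "F_tensor J g D X Y Z = g (cov_J D J X Y) Z"

definition basis_at ::
    "('m, 'e::euclidean_space) atlas \<Rightarrow> 'm \<Rightarrow> nat \<Rightarrow> (nat \<Rightarrow> 'm tvec) \<Rightarrow> bool" where
  "basis_at A x m e \<longleftrightarrow>
     (\<forall>i<m. e i \<in> tangent_space A x) \<and>
     (\<forall>c. (\<lambda>h. \<Sum>i<m. c i * e i h) = 0 \<longrightarrow> (\<forall>i<m. c i = 0)) \<and>
     (\<forall>v\<in>tangent_space A x. \<exists>c. v = (\<lambda>h. \<Sum>i<m. c i * e i h))"

definition inverse_matrix :: "nat \<Rightarrow> (nat \<Rightarrow> nat \<Rightarrow> real) \<Rightarrow> (nat \<Rightarrow> nat \<Rightarrow> real) \<Rightarrow> bool" where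
  "inverse_matrix m G H \<longleftrightarrow>
     (\<forall>i<m. \<forall>j<m. (\<Sum>k<m. G i k * H k j) = (if i = j then 1 else 0) \<and>
                  (\<Sum>k<m. H i k * G k j) = (if i = j then 1 else 0))"

text \<open>The tensors \<open>g\<close> and \<open>F\<close> are evaluated on a basis of the tangent space at \<open>x\<close> through smooth
  vector fields \<open>E i\<close> that extend the basis vectors.\<close>

definition lie_form ::
    "('m, 'e::euclidean_space) atlas \<Rightarrow> nat \<Rightarrow>
     ('m vfield \<Rightarrow> 'm vfield) \<Rightarrow> ('m vfield \<Rightarrow> 'm vfield \<Rightarrow> 'm \<Rightarrow> real) \<Rightarrow>
     ('m vfield \<Rightarrow> 'm vfield \<Rightarrow> 'm vfield) \<Rightarrow> ('m vfield \<Rightarrow> 'm \<Rightarrow> real) \<Rightarrow> bool" where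
  "lie_form A n J g D \<theta> \<longleftrightarrow>
     one_form A \<theta> \<and>
     (\<forall>x E ginv. (\<forall>i<2*n. E i \<in> vfields A) \<longrightarrow> basis_at A x (2*n) (\<lambda>i. E i x) \<longrightarrow>
        inverse_matrix (2*n) (\<lambda>i j. g (E i) (E j) x) ginv \<longrightarrow>
        (\<forall>Z\<in>vfields A.
           \<theta> Z x = (\<Sum>i<2*n. \<Sum>j<2*n. ginv i j * F_tensor J g D (E i) (E j) Z x)))"

definition lie_vector ::
    "('m, 'e::euclidean_space) atlas \<Rightarrow> ('m vfield \<Rightarrow> 'm vfield \<Rightarrow> 'm \<Rightarrow> real) \<Rightarrow>
     ('m vfield \<Rightarrow> 'm \<Rightarrow> real) \<Rightarrow> 'm vfield \<Rightarrow> bool" where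
  "lie_vector A g \<theta> \<Omega> \<longleftrightarrow> \<Omega> \<in> vfields A \<and> (\<forall>Z\<in>vfields A. \<theta> Z = g Z \<Omega>)"

text \<open>In the next two definitions \<open>D\<close> is meant to be the Levi-Civita connection of \<open>g\<close> and \<open>\<theta>\<close> the
  associated Lie form.\<close>

definition W1_manifold ::
    "('m::{t2_space,second_countable_topology}, 'e::euclidean_space) atlas \<Rightarrow> nat \<Rightarrow>
     ('m vfield \<Rightarrow> 'm vfield) \<Rightarrow> ('m vfield \<Rightarrow> 'm vfield \<Rightarrow> 'm \<Rightarrow> real) \<Rightarrow>
     ('m vfield \<Rightarrow> 'm vfield \<Rightarrow> 'm vfield) \<Rightarrow> ('m vfield \<Rightarrow> 'm \<Rightarrow> real) \<Rightarrow> bool" where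
  "W1_manifold A n J g D \<theta> \<longleftrightarrow>
     norden_manifold A n J g \<and> levi_civita A g D \<and> lie_form A n J g D \<theta> \<and>
     (\<forall>X\<in>vfields A. \<forall>Y\<in>vfields A. \<forall>Z\<in>vfields A. \<forall>x.
        F_tensor J g D X Y Z x =
          1 / (2 * real n) *
            (g X Y x * \<theta> Z x + g X (J Y) x * \<theta> (J Z) x
             + g X Z x * \<theta> Y x + g X (J Z) x * \<theta> (J Y) x))"

definition conformal_kahler_norden ::
    "('m::{t2_space,second_countable_topology}, 'e::euclidean_space) atlas \<Rightarrow> nat \<Rightarrow>
     ('m vfield \<Rightarrow> 'm vfield) \<Rightarrow> ('m vfield \<Rightarrow> 'm vfield \<Rightarrow> 'm \<Rightarrow> real) \<Rightarrow>
     ('m vfield \<Rightarrow> 'm vfield \<Rightarrow> 'm vfield) \<Rightarrow> ('m vfield \<Rightarrow> 'm \<Rightarrow> real) \<Rightarrow> bool" where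
  "conformal_kahler_norden A n J g D \<theta> \<longleftrightarrow>
     W1_manifold A n J g D \<theta> \<and> closed_one_form A \<theta> \<and> closed_one_form A (\<theta> \<circ> J)"

section \<open>The tensors and the connection of the theorem\<close>

definition psi1 ::
    "('m vfield \<Rightarrow> 'm vfield \<Rightarrow> 'm \<Rightarrow> real) \<Rightarrow> ('m vfield \<Rightarrow> 'm vfield \<Rightarrow> 'm \<Rightarrow> real) \<Rightarrow>
     'm vfield \<Rightarrow> 'm vfield \<Rightarrow> 'm vfield \<Rightarrow> 'm vfield \<Rightarrow> 'm \<Rightarrow> real" where
  "psi1 g S X Y Z W = g Y Z * S X W - g X Z * S Y W + g X W * S Y Z - g Y W * S X Z"

definition psi2 ::
    "('m vfield \<Rightarrow> 'm vfield) \<Rightarrow> ('m vfield \<Rightarrow> 'm vfield \<Rightarrow> 'm \<Rightarrow> real) \<Rightarrow>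
     ('m vfield \<Rightarrow> 'm vfield \<Rightarrow> 'm \<Rightarrow> real) \<Rightarrow>
     'm vfield \<Rightarrow> 'm vfield \<Rightarrow> 'm vfield \<Rightarrow> 'm vfield \<Rightarrow> 'm \<Rightarrow> real" where
  "psi2 J g S X Y Z W =
     g Y (J Z) * S X (J W) - g X (J Z) * S Y (J W) + g X (J W) * S Y (J Z) - g Y (J W) * S X (J Z)"

definition g_tilde ::
    "('m vfield \<Rightarrow> 'm vfield) \<Rightarrow> ('m vfield \<Rightarrow> 'm vfield \<Rightarrow> 'm \<Rightarrow> real) \<Rightarrow>
     'm vfield \<Rightarrow> 'm vfield \<Rightarrow> 'm \<Rightarrow> real" where
  "g_tilde J g X Y = g X (J Y)"

definition pi1 ::
    "('m vfield \<Rightarrow> 'm vfield \<Rightarrow> 'm \<Rightarrow> real) \<Rightarrow>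
     'm vfield \<Rightarrow> 'm vfield \<Rightarrow> 'm vfield \<Rightarrow> 'm vfield \<Rightarrow> 'm \<Rightarrow> real" where
  "pi1 g X Y Z W = (\<lambda>x. 1/2 * psi1 g g X Y Z W x)"

definition pi2 ::
    "('m vfield \<Rightarrow> 'm vfield) \<Rightarrow> ('m vfield \<Rightarrow> 'm vfield \<Rightarrow> 'm \<Rightarrow> real) \<Rightarrow>
     'm vfield \<Rightarrow> 'm vfield \<Rightarrow> 'm vfield \<Rightarrow> 'm vfield \<Rightarrow> 'm \<Rightarrow> real" where
  "pi2 J g X Y Z W = (\<lambda>x. 1/2 * psi2 J g g X Y Z W x)"

text \<open>On a manifold with Norden metric this also equals \<open>psi2 J g (g_tilde J g)\<close>.\<close>

definition pi3 ::
    "('m vfield \<Rightarrow> 'm vfield) \<Rightarrow> ('m vfield \<Rightarrow> 'm vfield \<Rightarrow> 'm \<Rightarrow> real) \<Rightarrow>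
     'm vfield \<Rightarrow> 'm vfield \<Rightarrow> 'm vfield \<Rightarrow> 'm vfield \<Rightarrow> 'm \<Rightarrow> real" where
  "pi3 J g X Y Z W = - psi1 g (g_tilde J g) X Y Z W"

definition complex_conn ::
    "('m vfield \<Rightarrow> 'm vfield) \<Rightarrow> ('m vfield \<Rightarrow> 'm vfield \<Rightarrow> 'm vfield) \<Rightarrow> real \<Rightarrow> real \<Rightarrow>
     'm vfield \<Rightarrow> 'm vfield \<Rightarrow> 'm vfield" where
  "complex_conn J D p q X Y =
     D X Y + (1/2) \<cdot>\<^sub>R cov_J D J X (J Y)
     + p \<cdot>\<^sub>R (cov_J D J Y X + cov_J D J (J Y) (J X))
     + q \<cdot>\<^sub>R (cov_J D J Y (J X) - cov_J D J (J Y) X)"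

definition S_tensor ::
    "nat \<Rightarrow> ('m vfield \<Rightarrow> 'm vfield) \<Rightarrow> ('m vfield \<Rightarrow> 'm vfield \<Rightarrow> 'm vfield) \<Rightarrow>
     ('m vfield \<Rightarrow> 'm \<Rightarrow> real) \<Rightarrow> 'm vfield \<Rightarrow> 'm vfield \<Rightarrow> 'm \<Rightarrow> real" where
  "S_tensor n J D \<theta> X Y = (\<lambda>x.
     cov_form D \<theta> X (J Y) x + 1 / (4 * real n) * (\<theta> X x * \<theta> Y x - \<theta> (J X) x * \<theta> (J Y) x))"

definition P_tensor ::
    "('m vfield \<Rightarrow> 'm vfield) \<Rightarrow> ('m vfield \<Rightarrow> 'm \<Rightarrow> real) \<Rightarrow>
     'm vfield \<Rightarrow> 'm vfield \<Rightarrow> 'm \<Rightarrow> real" where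
  "P_tensor J \<theta> X Y = \<theta> X * \<theta> Y + \<theta> (J X) * \<theta> (J Y)"

end

theory Submission
  imports Defs
begin

text \<open>
  Write \<open>k = 1 / (4n)\<close>. Nondegeneracy of \<open>g\<close> turns the \<open>W\<^sub>1\<close> condition into an explicit formula for
  \<open>(D\<^sub>X J) Y\<close>, from which \<open>\<nabla>'\<^sub>X Y = D\<^sub>X Y + Q(X, Y) + \<eta>(X) Y + \<zeta>(X) J Y\<close>, where
  \<open>Q(X, Y) = (D\<^sub>X J) J Y / 2\<close> and \<open>\<eta>\<close>, \<open>\<zeta>\<close> are linear combinations of \<open>\<theta>\<close> and \<open>\<theta> \<circ> J\<close>. The
  parameters \<open>p\<close> and \<open>q\<close> occur only in \<open>\<eta>\<close> and \<open>\<zeta>\<close>; as these are closed and \<open>D + Q\<close> commutes with \<open>J\<close>,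
  they do not affect the curvature. The curvature of \<open>D + Q\<close> is that of \<open>D\<close> plus the
  antisymmetrised covariant derivative of \<open>Q\<close> plus a term quadratic in \<open>Q\<close>, and expanding it gives the
  formula. Closedness of \<open>\<theta> \<circ> J\<close> makes \<open>S\<close> symmetric, hence the first Bianchi identity for \<open>R'\<close>;
  \<open>\<nabla>' J = 0\<close> gives the Kaehler property.
\<close>

section \<open>Smooth functions and vector fields\<close>

lemma Ck_on_cong:
  assumes "open U" "\<And>x. x \<in> U \<Longrightarrow> f x = h x" "Ck_on k f U"
  shows "Ck_on k h U"
  using assms(2,3)
proof (induction k arbitrary: f h)
  case 0
  then show ?case using continuous_on_cong[of U U f h] by simp
next
  case (Suc k)
  \<comment> \<open>Since \<open>U\<close> is open, the derivative at a point of \<open>U\<close>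
    depends only on values in \<open>U\<close>; the induction hypothesis can then be applied to the
    derivatives.\<close>
  have eq: "frechet_derivative f (at x) = frechet_derivative h (at x)" if "x \<in> U" for x
  proof -
    have "f differentiable (at x)"
      using Suc.prems(2) that \<open>open U\<close> by (auto simp: differentiable_on_eq_differentiable_at)
    then have "(f has_derivative frechet_derivative f (at x)) (at x)"
      using frechet_derivative_works by blast
    then have "(h has_derivative frechet_derivative f (at x)) (at x)"
      by (rule has_derivative_transform_within_open[OF _ \<open>open U\<close> that]) (use Suc.prems(1) in auto)
    then show ?thesis by (rule frechet_derivative_at)
  qed
  have "h differentiable_on U"
    using Suc.prems by (auto simp: differentiable_on_def intro: differentiable_transform_within[of _ _ _ 1])
  moreover have "Ck_on k (\<lambda>x. frechet_derivative h (at x) v) U" for v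
    by (rule Suc.IH[of "\<lambda>x. frechet_derivative f (at x) v"]) (use eq Suc.prems(2) in auto)
  ultimately show ?case by simp
qed

lemma Ck_on_const: "Ck_on k (\<lambda>_. c) U"
  by (induction k arbitrary: c) auto

lemma Ck_on_Suc_D: "Ck_on (Suc k) f U \<Longrightarrow> Ck_on k f U"
  by (induction k arbitrary: f) (auto simp: differentiable_imp_continuous_on)

lemma Ck_on_Suc_has_derivative:
  assumes "open U" "Ck_on (Suc k) f U" "x \<in> U"
  shows "(f has_derivative frechet_derivative f (at x)) (at x)"
  using assms by (auto simp: differentiable_on_eq_differentiable_at frechet_derivative_works)

lemma Ck_on_add:
  assumes "open U" "Ck_on k f U" "Ck_on k h U"
  shows "Ck_on k (\<lambda>x. f x + h x) U"
  using assms(2,3)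
proof (induction k arbitrary: f h)
  case 0
  then show ?case by (simp add: continuous_on_add)
next
  case (Suc k)
  have "frechet_derivative (\<lambda>x. f x + h x) (at x)
      = (\<lambda>v. frechet_derivative f (at x) v + frechet_derivative h (at x) v)" if "x \<in> U" for x
    using has_derivative_add[OF Ck_on_Suc_has_derivative[OF \<open>open U\<close> Suc.prems(1) that]
        Ck_on_Suc_has_derivative[OF \<open>open U\<close> Suc.prems(2) that]]
    by (simp add: frechet_derivative_at[symmetric])
  moreover have "Ck_on k (\<lambda>x. frechet_derivative f (at x) v + frechet_derivative h (at x) v) U" for v
    using Suc.prems by (intro Suc.IH) auto
  ultimately have "Ck_on k (\<lambda>x. frechet_derivative (\<lambda>x. f x + h x) (at x) v) U" for v
    by (rule_tac Ck_on_cong[OF \<open>open U\<close>]) auto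
  then show ?case using Suc.prems by simp
qed

text \<open>The product rule leaves one undifferentiated factor in each term;
  \<open>Ck_on_Suc_D\<close> lowers its order to \<open>k\<close>, so that the induction hypothesis
  covers both products.\<close>

lemma Ck_on_mult:
  fixes f h :: "'a::real_normed_vector \<Rightarrow> real"
  assumes "open U" "Ck_on k f U" "Ck_on k h U"
  shows "Ck_on k (\<lambda>x. f x * h x) U"
  using assms(2,3)
proof (induction k arbitrary: f h)
  case 0
  then show ?case by (simp add: continuous_on_mult)
next
  case (Suc k)
  have "frechet_derivative (\<lambda>x. f x * h x) (at x)
      = (\<lambda>v. f x * frechet_derivative h (at x) v + frechet_derivative f (at x) v * h x)"
    if "x \<in> U" for x
    using has_derivative_mult[OF Ck_on_Suc_has_derivative[OF \<open>open U\<close> Suc.prems(1) that]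
        Ck_on_Suc_has_derivative[OF \<open>open U\<close> Suc.prems(2) that]]
    by (simp add: frechet_derivative_at[symmetric])
  moreover have "Ck_on k (\<lambda>x. f x * frechet_derivative h (at x) v + frechet_derivative f (at x) v * h x) U"
    for v
    using Suc.prems by (intro Ck_on_add[OF \<open>open U\<close>] Suc.IH Ck_on_Suc_D[OF Suc.prems(1)]
        Ck_on_Suc_D[OF Suc.prems(2)]) auto
  ultimately have "Ck_on k (\<lambda>x. frechet_derivative (\<lambda>x. f x * h x) (at x) v) U" for v
    by (rule_tac Ck_on_cong[OF \<open>open U\<close>]) auto
  then show ?case using Suc.prems by simp
qed

section \<open>The algebra of smooth functions and its derivations\<close>

abbreviation const_fun :: "real \<Rightarrow> 'm \<Rightarrow> real" where
  "const_fun c \<equiv> (\<lambda>_. c)"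

locale smooth_manifold =
  fixes A :: "('m::{t2_space,second_countable_topology}, 'e::euclidean_space) atlas"
  assumes atlas: "smooth_atlas A"
begin

lemma open_chart_image: "(U, \<phi>) \<in> A \<Longrightarrow> open (\<phi> ` U)"
  using atlas by (auto simp: smooth_atlas_def)

lemma Cinf_const [simp]: "const_fun c \<in> Cinf A"
  by (auto simp: Cinf_def smooth_on_def o_def Ck_on_const)

lemma Cinf_zero [simp]: "0 \<in> Cinf A"
  using Cinf_const[of 0] by (simp add: zero_fun_def)

lemma Cinf_one [simp]: "1 \<in> Cinf A"
  using Cinf_const[of 1] by (simp add: one_fun_def)

lemma Cinf_add [simp]: "f \<in> Cinf A \<Longrightarrow> h \<in> Cinf A \<Longrightarrow> f + h \<in> Cinf A"
  using open_chart_image by (auto simp: Cinf_def smooth_on_def o_def split_beta intro!: Ck_on_add)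

lemma Cinf_mult [simp]: "f \<in> Cinf A \<Longrightarrow> h \<in> Cinf A \<Longrightarrow> f * h \<in> Cinf A"
  using open_chart_image by (auto simp: Cinf_def smooth_on_def o_def split_beta intro!: Ck_on_mult)

lemma Cinf_uminus [simp]: "f \<in> Cinf A \<Longrightarrow> - f \<in> Cinf A"
  using Cinf_mult[of "const_fun (-1)" f] by (simp add: times_fun_def fun_Compl_def)

lemma Cinf_diff [simp]: "f \<in> Cinf A \<Longrightarrow> h \<in> Cinf A \<Longrightarrow> f - h \<in> Cinf A"
  using Cinf_add[of f "- h"] by simp

lemma tangent_spaceI:
  assumes "\<And>f h. f \<in> Cinf A \<Longrightarrow> h \<in> Cinf A \<Longrightarrow> v (f + h) = v f + v h"
    and "\<And>c f. f \<in> Cinf A \<Longrightarrow> v (\<lambda>y. c * f y) = c * v f"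
    and "\<And>f h. f \<in> Cinf A \<Longrightarrow> h \<in> Cinf A \<Longrightarrow> v (f * h) = v f * h x + f x * v h"
    and "\<And>f. f \<notin> Cinf A \<Longrightarrow> v f = 0"
  shows "v \<in> tangent_space A x"
  using assms by (simp add: tangent_space_def)

lemma tangent_vector:
  assumes "v \<in> tangent_space A x"
  shows tangent_add: "f \<in> Cinf A \<Longrightarrow> h \<in> Cinf A \<Longrightarrow> v (f + h) = v f + v h"
    and tangent_mult: "f \<in> Cinf A \<Longrightarrow> h \<in> Cinf A \<Longrightarrow> v (f * h) = v f * h x + f x * v h"
    and tangent_scale: "f \<in> Cinf A \<Longrightarrow> v (\<lambda>y. c * f y) = c * v f"
    and tangent_outside: "f \<notin> Cinf A \<Longrightarrow> v f = 0"
  using assms by (auto simp: tangent_space_def)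

lemma tangent_const:
  assumes "v \<in> tangent_space A x"
  shows "v (const_fun c) = 0"
proof -
  have "v (1 * 1) = v 1 + v 1"
    using tangent_mult[OF assms, of 1 1] by simp
  then have "v 1 = 0" by simp
  moreover have "v (\<lambda>y. c * (1 :: 'm \<Rightarrow> real) y) = c * v 1"
    using tangent_scale[OF assms Cinf_one] .
  ultimately show ?thesis by simp
qed

lemma tangent_zero: "v \<in> tangent_space A x \<Longrightarrow> v 0 = 0"
  using tangent_const[of v x 0] by (simp add: zero_fun_def)

section \<open>Vector fields and the Lie bracket\<close>

lemma vfield_tangent: "X \<in> vfields A \<Longrightarrow> X x \<in> tangent_space A x"
  by (simp add: vfields_def)

lemma vfieldsI:
  "(\<And>x. X x \<in> tangent_space A x) \<Longrightarrow> (\<And>f. f \<in> Cinf A \<Longrightarrow> act X f \<in> Cinf A) \<Longrightarrow> X \<in> vfields A"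
  by (simp add: vfields_def)

lemma act_Cinf [simp]: "X \<in> vfields A \<Longrightarrow> f \<in> Cinf A \<Longrightarrow> act X f \<in> Cinf A"
  by (simp add: vfields_def)

lemma act_add:
  "X \<in> vfields A \<Longrightarrow> f \<in> Cinf A \<Longrightarrow> h \<in> Cinf A \<Longrightarrow> act X (f + h) = act X f + act X h"
  by (auto simp: act_def fun_eq_iff tangent_add[OF vfield_tangent])

lemma act_mult:
  "X \<in> vfields A \<Longrightarrow> f \<in> Cinf A \<Longrightarrow> h \<in> Cinf A \<Longrightarrow> act X (f * h) = act X f * h + f * act X h"
  by (auto simp: act_def fun_eq_iff tangent_mult[OF vfield_tangent])

lemma act_const: "X \<in> vfields A \<Longrightarrow> act X (const_fun c) = 0"
  by (auto simp: act_def fun_eq_iff tangent_const[OF vfield_tangent])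

lemma act_outside: "X \<in> vfields A \<Longrightarrow> f \<notin> Cinf A \<Longrightarrow> act X f = 0"
  by (auto simp: act_def fun_eq_iff tangent_outside[OF vfield_tangent])

lemma act_uminus: "X \<in> vfields A \<Longrightarrow> f \<in> Cinf A \<Longrightarrow> act X (- f) = - act X f"
  using act_mult[of X "const_fun (-1)" f]
  by (simp add: act_const times_fun_def fun_Compl_def plus_fun_def)

lemma act_diff:
  "X \<in> vfields A \<Longrightarrow> f \<in> Cinf A \<Longrightarrow> h \<in> Cinf A \<Longrightarrow> act X (f - h) = act X f - act X h"
  using act_add[of X f "- h"] by (simp add: act_uminus)

lemma vfields_add [simp]:
  assumes "X \<in> vfields A" "Y \<in> vfields A"
  shows "X + Y \<in> vfields A"
proof -
  have "act (X + Y) f = act X f + act Y f" for f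
    by (simp add: act_def fun_eq_iff)
  moreover have "(X + Y) x \<in> tangent_space A x" for x
    using vfield_tangent[OF assms(1), of x] vfield_tangent[OF assms(2), of x]
    by (intro tangent_spaceI)
      (simp_all add: tangent_add tangent_scale tangent_mult tangent_outside distrib_left distrib_right)
  ultimately show ?thesis using assms by (intro vfieldsI) simp_all
qed

lemma vfields_fscale [simp]:
  assumes "f \<in> Cinf A" "X \<in> vfields A"
  shows "f \<odot> X \<in> vfields A"
proof -
  have "act (f \<odot> X) h = f * act X h" for h
    by (simp add: act_def fscale_def fun_eq_iff)
  moreover have "(f \<odot> X) x \<in> tangent_space A x" for x
    using vfield_tangent[OF assms(2), of x]
    by (intro tangent_spaceI)
      (simp_all add: fscale_def tangent_add tangent_scale tangent_mult tangent_outside distrib_left)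
  ultimately show ?thesis using assms by (intro vfieldsI) simp_all
qed

lemma rscale_eq_fscale: "c \<cdot>\<^sub>R X = const_fun c \<odot> X"
  by (simp add: rscale_def fscale_def)

lemma uminus_eq_fscale: "- X = const_fun (-1) \<odot> X"
  by (simp add: fscale_def fun_eq_iff)

lemma vfields_rscale [simp]: "X \<in> vfields A \<Longrightarrow> c \<cdot>\<^sub>R X \<in> vfields A"
  by (simp add: rscale_eq_fscale)

lemma vfields_uminus [simp]: "X \<in> vfields A \<Longrightarrow> - X \<in> vfields A"
  by (simp add: uminus_eq_fscale)

lemma vfields_diff [simp]: "X \<in> vfields A \<Longrightarrow> Y \<in> vfields A \<Longrightarrow> X - Y \<in> vfields A"
  using vfields_add[of X "- Y"] by simp

lemma vfields_zero [simp]: "0 \<in> vfields A"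
  using tangent_zero by (auto simp: vfields_def tangent_space_def act_def zero_fun_def[symmetric])

lemma act_fscale: "act (f \<odot> X) h = f * act X h"
  by (simp add: act_def fscale_def fun_eq_iff)

lemma act_lie_bracket:
  "act (lie_bracket X Y) h = act X (act Y h) - act Y (act X h)"
  by (simp add: act_def lie_bracket_def fun_eq_iff)

lemma lie_bracket_swap: "lie_bracket Y X = - lie_bracket X Y"
  by (simp add: lie_bracket_def fun_eq_iff)

text \<open>In the Leibniz rule for the commutator the mixed products of first derivatives of the
  two factors occur twice with opposite signs, so it is again a derivation.\<close>

lemma lie_bracket_closed [simp]:
  assumes X: "X \<in> vfields A" and Y: "Y \<in> vfields A"
  shows "lie_bracket X Y \<in> vfields A"
proof (rule vfieldsI)
  show "act (lie_bracket X Y) f \<in> Cinf A" if "f \<in> Cinf A" for f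
    using assms that by (simp add: act_lie_bracket)
  fix x
  have act: "act (lie_bracket X Y) f x = lie_bracket X Y x f" for f
    by (simp add: act_def)
  \<comment> \<open>Serves the non-smooth arguments: there the inner derivative takes the default
    value 0, to which the outer one is then applied.\<close>
  have zero: "act V 0 = 0" if "V \<in> vfields A" for V
    using act_const[OF that, of 0] by (simp add: zero_fun_def)
  show "lie_bracket X Y x \<in> tangent_space A x"
  proof (rule tangent_spaceI; unfold act[symmetric])
    show "act (lie_bracket X Y) (\<lambda>y. c * f y) x = c * act (lie_bracket X Y) f x"
      if "f \<in> Cinf A" for c f
    proof -
      have "act V (const_fun c * h) = const_fun c * act V h"
        if "V \<in> vfields A" "h \<in> Cinf A" for V h
        using that by (simp add: act_mult act_const)
      then have "act (lie_bracket X Y) (const_fun c * f) x = c * act (lie_bracket X Y) f x"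
        using assms that by (simp add: act_lie_bracket right_diff_distrib)
      then show ?thesis by (simp add: times_fun_def)
    qed
  qed (use assms in \<open>simp_all add: act_lie_bracket act_add act_mult act_outside zero algebra_simps\<close>)
qed

text \<open>The convention that tangent vectors vanish on non-smooth functions makes smooth test
  functions enough for equality in HOL.\<close>

lemma vfield_act_eqI:
  assumes "X \<in> vfields A" "Y \<in> vfields A" "\<And>h. h \<in> Cinf A \<Longrightarrow> act X h = act Y h"
  shows "X = Y"
proof (intro ext)
  fix x h
  have "act X h = act Y h"
    using assms act_outside[of X h] act_outside[of Y h] by (cases "h \<in> Cinf A") auto
  then show "X x h = Y x h" by (simp add: act_def fun_eq_iff)
qed

lemma act_vfield_add: "act (X + Y) h = act X h + act Y h"
  and act_vfield_diff: "act (X - Y) h = act X h - act Y h"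
  by (simp_all add: act_def fun_eq_iff)

lemma lie_bracket_add_left:
  assumes "X \<in> vfields A" "X' \<in> vfields A" "Y \<in> vfields A"
  shows "lie_bracket (X + X') Y = lie_bracket X Y + lie_bracket X' Y"
  using assms
  by (intro vfield_act_eqI) (simp_all add: act_lie_bracket act_vfield_add act_add algebra_simps)

lemma lie_bracket_fscale_left:
  assumes "f \<in> Cinf A" "X \<in> vfields A" "Y \<in> vfields A"
  shows "lie_bracket (f \<odot> X) Y = f \<odot> lie_bracket X Y - act Y f \<odot> X"
  using assms
  by (intro vfield_act_eqI)
    (simp_all add: act_lie_bracket act_vfield_diff act_fscale act_mult algebra_simps)

text \<open>Applied to a function, the double brackets expand into third-order derivatives that
  cancel in pairs over the cyclic sum.\<close>

lemma jacobi:
  assumes "X \<in> vfields A" "Y \<in> vfields A" "Z \<in> vfields A"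
  shows "lie_bracket X (lie_bracket Y Z) + lie_bracket Y (lie_bracket Z X)
    + lie_bracket Z (lie_bracket X Y) = 0"
proof (rule vfield_act_eqI)
  show "act (lie_bracket X (lie_bracket Y Z) + lie_bracket Y (lie_bracket Z X)
    + lie_bracket Z (lie_bracket X Y)) h = act 0 h" if "h \<in> Cinf A" for h
    using assms that
    by (simp add: act_lie_bracket act_vfield_add act_diff) (simp add: act_def fun_eq_iff)
qed (use assms in simp_all)

text \<open>The simplified formula for \<open>complex_conn\<close> holds on smooth vector fields
  only, so the two maps cannot simply be identified. Closure under \<open>D\<close> keeps the
  iterated derivatives inside that domain.\<close>

lemma curvature_cong:
  assumes "\<And>X Y. X \<in> vfields A \<Longrightarrow> Y \<in> vfields A \<Longrightarrow> D' X Y = D X Y"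
    and "\<And>X Y. X \<in> vfields A \<Longrightarrow> Y \<in> vfields A \<Longrightarrow> D X Y \<in> vfields A"
    and "X \<in> vfields A" "Y \<in> vfields A" "Z \<in> vfields A"
  shows "curvature D' X Y Z = curvature D X Y Z"
  using assms by (simp add: curvature_def)

section \<open>One-forms\<close>

lemma one_form_rules:
  assumes "one_form A \<omega>"
  shows one_form_Cinf: "X \<in> vfields A \<Longrightarrow> \<omega> X \<in> Cinf A"
    and one_form_add: "X \<in> vfields A \<Longrightarrow> Y \<in> vfields A \<Longrightarrow> \<omega> (X + Y) = \<omega> X + \<omega> Y"
    and one_form_fscale: "f \<in> Cinf A \<Longrightarrow> X \<in> vfields A \<Longrightarrow> \<omega> (f \<odot> X) = f * \<omega> X"
    and one_form_uminus: "X \<in> vfields A \<Longrightarrow> \<omega> (- X) = - \<omega> X"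
    and one_form_diff: "X \<in> vfields A \<Longrightarrow> Y \<in> vfields A \<Longrightarrow> \<omega> (X - Y) = \<omega> X - \<omega> Y"
proof -
  have add: "\<omega> (X + Y) = \<omega> X + \<omega> Y" if "X \<in> vfields A" "Y \<in> vfields A" for X Y
    using assms that by (simp add: one_form_def)
  have scale: "\<omega> (f \<odot> X) = f * \<omega> X" if "f \<in> Cinf A" "X \<in> vfields A" for f X
    using assms that by (simp add: one_form_def)
  have minus: "\<omega> (- X) = - \<omega> X" if "X \<in> vfields A" for X
    unfolding uminus_eq_fscale using that by (simp add: scale fun_eq_iff)
  show "X \<in> vfields A \<Longrightarrow> \<omega> X \<in> Cinf A"
    using assms by (simp add: one_form_def)
  show "X \<in> vfields A \<Longrightarrow> Y \<in> vfields A \<Longrightarrow> \<omega> (X + Y) = \<omega> X + \<omega> Y"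
    "f \<in> Cinf A \<Longrightarrow> X \<in> vfields A \<Longrightarrow> \<omega> (f \<odot> X) = f * \<omega> X"
    "X \<in> vfields A \<Longrightarrow> \<omega> (- X) = - \<omega> X"
    by (fact add scale minus)+
  show "X \<in> vfields A \<Longrightarrow> Y \<in> vfields A \<Longrightarrow> \<omega> (X - Y) = \<omega> X - \<omega> Y"
    using add[of X "- Y"] minus[of Y] by simp
qed

lemma one_formI:
  assumes "\<And>X. X \<in> vfields A \<Longrightarrow> \<omega> X \<in> Cinf A"
    and "\<And>X Y. X \<in> vfields A \<Longrightarrow> Y \<in> vfields A \<Longrightarrow> \<omega> (X + Y) = \<omega> X + \<omega> Y"
    and "\<And>f X. f \<in> Cinf A \<Longrightarrow> X \<in> vfields A \<Longrightarrow> \<omega> (f \<odot> X) = f * \<omega> X"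
  shows "one_form A \<omega>"
  using assms by (simp add: one_form_def)

end

section \<open>Affine connections\<close>

text \<open>Kept apart from the metric and \<open>J\<close> because it is used for three
  connections: \<open>D\<close>, \<open>D + Q\<close> and \<open>complex_conn\<close>.\<close>

locale smooth_connection = smooth_manifold A
  for A :: "('m::{t2_space,second_countable_topology}, 'e::euclidean_space) atlas" +
  fixes D :: "'m vfield \<Rightarrow> 'm vfield \<Rightarrow> 'm vfield"
  assumes affine: "affine_connection A D"
begin

lemma conn_closed [simp]: "X \<in> vfields A \<Longrightarrow> Y \<in> vfields A \<Longrightarrow> D X Y \<in> vfields A"
  and conn_add_left: "X \<in> vfields A \<Longrightarrow> Y \<in> vfields A \<Longrightarrow> Z \<in> vfields A \<Longrightarrow> D (X + Y) Z = D X Z + D Y Z"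
  and conn_fscale_left: "f \<in> Cinf A \<Longrightarrow> X \<in> vfields A \<Longrightarrow> Y \<in> vfields A \<Longrightarrow> D (f \<odot> X) Y = f \<odot> D X Y"
  and conn_add_right: "X \<in> vfields A \<Longrightarrow> Y \<in> vfields A \<Longrightarrow> Z \<in> vfields A \<Longrightarrow> D X (Y + Z) = D X Y + D X Z"
  and conn_leibniz: "f \<in> Cinf A \<Longrightarrow> X \<in> vfields A \<Longrightarrow> Y \<in> vfields A \<Longrightarrow> D X (f \<odot> Y) = act X f \<odot> Y + f \<odot> D X Y"
  using affine by (simp_all add: affine_connection_def)

lemma conn_uminus_left: "X \<in> vfields A \<Longrightarrow> Y \<in> vfields A \<Longrightarrow> D (- X) Y = - D X Y"
  by (simp add: uminus_eq_fscale conn_fscale_left)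

lemma conn_diff_left:
  "X \<in> vfields A \<Longrightarrow> Y \<in> vfields A \<Longrightarrow> Z \<in> vfields A \<Longrightarrow> D (X - Y) Z = D X Z - D Y Z"
  using conn_add_left[of X "- Y" Z] by (simp add: conn_uminus_left)

lemma conn_uminus_right: "X \<in> vfields A \<Longrightarrow> Y \<in> vfields A \<Longrightarrow> D X (- Y) = - D X Y"
  by (simp add: uminus_eq_fscale conn_leibniz act_const) (simp add: fscale_def fun_eq_iff)

lemma conn_diff_right:
  "X \<in> vfields A \<Longrightarrow> Y \<in> vfields A \<Longrightarrow> Z \<in> vfields A \<Longrightarrow> D X (Y - Z) = D X Y - D X Z"
  using conn_add_right[of X Y "- Z"] by (simp add: conn_uminus_right)

lemmas conn_simps = conn_add_left conn_fscale_left conn_add_right conn_leibniz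
  conn_uminus_left conn_uminus_right conn_diff_left conn_diff_right

section \<open>Tensoriality and symmetries of the curvature\<close>

lemma curvature_closed [simp]:
  "X \<in> vfields A \<Longrightarrow> Y \<in> vfields A \<Longrightarrow> Z \<in> vfields A \<Longrightarrow> curvature D X Y Z \<in> vfields A"
  by (simp add: curvature_def)

lemma curvature_swap:
  assumes "X \<in> vfields A" "Y \<in> vfields A" "Z \<in> vfields A"
  shows "curvature D Y X Z = - curvature D X Y Z"
  using assms by (simp add: curvature_def lie_bracket_swap[of X Y] conn_uminus_left)

lemma curvature_add_left:
  assumes "X \<in> vfields A" "X' \<in> vfields A" "Y \<in> vfields A" "Z \<in> vfields A"
  shows "curvature D (X + X') Y Z = curvature D X Y Z + curvature D X' Y Z"
  using assms by (simp add: curvature_def lie_bracket_add_left conn_simps)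

text \<open>The term \<open>act Y f \<odot> D X Z\<close> produced by the Leibniz rule in
  \<open>D Y (f \<odot> D X Z)\<close> is cancelled by the extra term of the bracket of
  \<open>f \<odot> X\<close> and \<open>Y\<close>.\<close>

lemma curvature_fscale_left:
  assumes "f \<in> Cinf A" "X \<in> vfields A" "Y \<in> vfields A" "Z \<in> vfields A"
  shows "curvature D (f \<odot> X) Y Z = f \<odot> curvature D X Y Z"
  using assms
  by (simp add: curvature_def lie_bracket_fscale_left conn_simps)
    (simp add: fscale_def fun_eq_iff algebra_simps)

lemma curvature_add_middle:
  assumes "X \<in> vfields A" "Y \<in> vfields A" "Y' \<in> vfields A" "Z \<in> vfields A"
  shows "curvature D X (Y + Y') Z = curvature D X Y Z + curvature D X Y' Z"
  using assms by (simp add: curvature_swap[of _ X] curvature_add_left)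

lemma curvature_fscale_middle:
  assumes "f \<in> Cinf A" "X \<in> vfields A" "Y \<in> vfields A" "Z \<in> vfields A"
  shows "curvature D X (f \<odot> Y) Z = f \<odot> curvature D X Y Z"
  using assms by (simp add: curvature_swap[of _ X] curvature_fscale_left) (simp add: fscale_def fun_eq_iff)

lemma curvature_add_right:
  assumes "X \<in> vfields A" "Y \<in> vfields A" "Z \<in> vfields A" "Z' \<in> vfields A"
  shows "curvature D X Y (Z + Z') = curvature D X Y Z + curvature D X Y Z'"
  using assms by (simp add: curvature_def conn_simps)

text \<open>First derivatives of \<open>f\<close> cancel between the two iterated derivatives, and
  the second derivatives combine to \<open>act (lie_bracket X Y) f\<close>, which the bracket term
  removes.\<close>

lemma curvature_fscale_right:
  assumes "f \<in> Cinf A" "X \<in> vfields A" "Y \<in> vfields A" "Z \<in> vfields A"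
  shows "curvature D X Y (f \<odot> Z) = f \<odot> curvature D X Y Z"
  using assms
  by (simp add: curvature_def conn_simps act_lie_bracket)
    (simp add: fscale_def fun_eq_iff algebra_simps)

lemma curvature04_tensor:
  assumes "tensor02 A g"
  shows "tensor04 A (curvature04 g D)"
proof -
  have g: "one_form A (\<lambda>Y. g X Y)" "one_form A (\<lambda>Y. g Y X)" if "X \<in> vfields A" for X
    using assms that by (simp_all add: tensor02_def)
  show ?thesis
    unfolding tensor04_def curvature04_def
    by (intro ballI conjI one_formI; (rule g(1))?)
      (simp_all add: one_form_Cinf[OF g(2)] one_form_add[OF g(2)] one_form_fscale[OF g(2)]
        one_form_Cinf[OF g(1)] one_form_add[OF g(1)] one_form_fscale[OF g(1)]
        curvature_add_left curvature_fscale_left curvature_add_middle curvature_fscale_middle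
        curvature_add_right curvature_fscale_right)
qed

text \<open>The commutator of \<open>X\<close> and \<open>Y\<close> applied to \<open>g Z W\<close>
  is computed in two ways, by iterating metric compatibility and by using it once for the bracket.
  The terms with one derivative on each argument are symmetric in \<open>X\<close> and
  \<open>Y\<close> and drop out.\<close>

lemma curvature04_skew:
  assumes g: "tensor02 A g" "\<And>X Y. X \<in> vfields A \<Longrightarrow> Y \<in> vfields A \<Longrightarrow> g X Y = g Y X"
    and metric: "\<And>X Y Z. X \<in> vfields A \<Longrightarrow> Y \<in> vfields A \<Longrightarrow> Z \<in> vfields A \<Longrightarrow>
      act X (g Y Z) = g (D X Y) Z + g Y (D X Z)"
    and XYZW: "X \<in> vfields A" "Y \<in> vfields A" "Z \<in> vfields A" "W \<in> vfields A"
  shows "curvature04 g D X Y Z W = - curvature04 g D X Y W Z"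
proof -
  have left: "one_form A (\<lambda>Y. g Y X)" and right: "one_form A (\<lambda>Y. g X Y)" if "X \<in> vfields A" for X
    using g(1) that by (simp_all add: tensor02_def)
  note rules = one_form_Cinf[OF left] one_form_diff[OF left] one_form_diff[OF right]
  have second: "act X (act Y (g Z W)) = g (D X (D Y Z)) W + g (D Y Z) (D X W) + g (D X Z) (D Y W)
      + g Z (D X (D Y W))" if "X \<in> vfields A" "Y \<in> vfields A" for X Y
    using that XYZW by (simp add: metric act_add rules)
  have "act (lie_bracket X Y) (g Z W) = g (D (lie_bracket X Y) Z) W + g Z (D (lie_bracket X Y) W)"
    using XYZW by (simp add: metric)
  moreover have "g (curvature D X Y Z) W = g (D X (D Y Z)) W - g (D Y (D X Z)) W - g (D (lie_bracket X Y) Z) W"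
    "g Z (curvature D X Y W) = g Z (D X (D Y W)) - g Z (D Y (D X W)) - g Z (D (lie_bracket X Y) W)"
    using XYZW by (simp_all add: curvature_def rules)
  ultimately have "g (curvature D X Y Z) W + g Z (curvature D X Y W)
      = act (lie_bracket X Y) (g Z W) - act (lie_bracket X Y) (g Z W)"
    using XYZW by (simp only: act_lie_bracket second) (simp add: algebra_simps)
  then show ?thesis
    using XYZW g(2)[of Z "curvature D X Y W"] by (simp add: curvature04_def eq_neg_iff_add_eq_0)
qed

text \<open>\<open>J\<close> passes through every derivative in the curvature. Together with the
  Norden condition this will give the Kaehler property.\<close>

lemma curvature_commute:
  assumes J: "tensor11 A J"
    and parallel: "\<And>X Y. X \<in> vfields A \<Longrightarrow> Y \<in> vfields A \<Longrightarrow> D X (J Y) = J (D X Y)"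
    and XYZ: "X \<in> vfields A" "Y \<in> vfields A" "Z \<in> vfields A"
  shows "curvature D X Y (J Z) = J (curvature D X Y Z)"
proof -
  have J_closed: "J X \<in> vfields A" if "X \<in> vfields A" for X
    using J that by (simp add: tensor11_def)
  have "J (X - Y) = J X - J Y" if "X \<in> vfields A" "Y \<in> vfields A" for X Y
  proof -
    have "J (X + const_fun (-1) \<odot> Y) = J X + const_fun (-1) \<odot> J Y"
      using J that by (simp add: tensor11_def)
    then show ?thesis by (simp add: uminus_eq_fscale[symmetric])
  qed
  then show ?thesis
    using XYZ by (simp add: curvature_def parallel J_closed)
qed

text \<open>The added endomorphisms \<open>\<eta> X + \<zeta> X J\<close> commute with each other and with \<open>D\<close>, so they contribute to
  the curvature only through \<open>d\<eta>\<close> and \<open>d\<zeta>\<close>, which vanish.\<close>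

lemma curvature_add_closed_forms:
  assumes J: "tensor11 A J" "\<And>X. X \<in> vfields A \<Longrightarrow> J (J X) = - X"
    and parallel: "\<And>X Y. X \<in> vfields A \<Longrightarrow> Y \<in> vfields A \<Longrightarrow> D X (J Y) = J (D X Y)"
    and closed: "closed_one_form A \<eta>" "closed_one_form A \<zeta>"
    and XYZ: "X \<in> vfields A" "Y \<in> vfields A" "Z \<in> vfields A"
  shows "curvature (\<lambda>X Y. D X Y + \<eta> X \<odot> Y + \<zeta> X \<odot> J Y) X Y Z = curvature D X Y Z"
proof -
  have J_simps: "\<And>X. X \<in> vfields A \<Longrightarrow> J X \<in> vfields A"
    "\<And>X Y. X \<in> vfields A \<Longrightarrow> Y \<in> vfields A \<Longrightarrow> J (X + Y) = J X + J Y"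
    "\<And>f X. f \<in> Cinf A \<Longrightarrow> X \<in> vfields A \<Longrightarrow> J (f \<odot> X) = f \<odot> J X"
    using J by (simp_all add: tensor11_def)
  have forms: "one_form A \<eta>" "one_form A \<zeta>"
    using closed by (simp_all add: closed_one_form_def)
  \<comment> \<open>Closedness is solved for the value on the bracket, so that it can serve as a
    rewrite rule inside the curvature.\<close>
  have bracket: "\<omega> (lie_bracket X Y) = act X (\<omega> Y) - act Y (\<omega> X)" if "closed_one_form A \<omega>" for \<omega>
  proof -
    have "act X (\<omega> Y) - act Y (\<omega> X) - \<omega> (lie_bracket X Y) = 0"
      using that XYZ by (simp add: closed_one_form_def)
    then show ?thesis by simp
  qed
  note bracket = bracket[OF closed(1)] bracket[OF closed(2)]
  show ?thesis
    using XYZ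
    by (simp add: curvature_def conn_simps J_simps J(2) parallel bracket one_form_Cinf[OF forms(1)]
        one_form_Cinf[OF forms(2)])
      (simp add: fscale_def fun_eq_iff algebra_simps)
qed

text \<open>The map \<open>T\<close> is the covariant derivative of the tensor \<open>Q\<close>.\<close>

lemma curvature_add_tensor:
  assumes torsion: "\<And>X Y. X \<in> vfields A \<Longrightarrow> Y \<in> vfields A \<Longrightarrow> D X Y - D Y X = lie_bracket X Y"
    and closed: "\<And>X Y. X \<in> vfields A \<Longrightarrow> Y \<in> vfields A \<Longrightarrow> Q X Y \<in> vfields A"
    and add_left: "\<And>X Y Z. X \<in> vfields A \<Longrightarrow> Y \<in> vfields A \<Longrightarrow> Z \<in> vfields A \<Longrightarrow> Q (X - Y) Z = Q X Z - Q Y Z"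
    and add_right: "\<And>X Y Z. X \<in> vfields A \<Longrightarrow> Y \<in> vfields A \<Longrightarrow> Z \<in> vfields A \<Longrightarrow> Q X (Y + Z) = Q X Y + Q X Z"
    and cov: "\<And>X Y Z. X \<in> vfields A \<Longrightarrow> Y \<in> vfields A \<Longrightarrow> Z \<in> vfields A \<Longrightarrow>
      D X (Q Y Z) = Q (D X Y) Z + Q Y (D X Z) + T X Y Z"
    and XYZ: "X \<in> vfields A" "Y \<in> vfields A" "Z \<in> vfields A"
  shows "curvature (\<lambda>X Y. D X Y + Q X Y) X Y Z
    = curvature D X Y Z + T X Y Z - T Y X Z + Q X (Q Y Z) - Q Y (Q X Z)"
proof -
  \<comment> \<open>Vanishing torsion splits the bracket term, which then cancels the
    \<open>Q (D X Y) Z\<close> and \<open>Q (D Y X) Z\<close> produced by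
    \<open>cov\<close>.\<close>
  have "Q (lie_bracket X Y) Z = Q (D X Y) Z - Q (D Y X) Z"
    using XYZ by (simp add: torsion[symmetric] add_left)
  then show ?thesis
    using XYZ by (simp add: curvature_def conn_add_right closed add_right cov algebra_simps)
qed

text \<open>Using vanishing torsion twice expresses a double bracket through \<open>D\<close>; the
  cyclic sum of these expressions is the cyclic sum of curvatures, and the Jacobi identity makes it
  zero.\<close>

lemma first_bianchi:
  assumes torsion: "\<And>X Y. X \<in> vfields A \<Longrightarrow> Y \<in> vfields A \<Longrightarrow> D X Y - D Y X = lie_bracket X Y"
    and XYZ: "X \<in> vfields A" "Y \<in> vfields A" "Z \<in> vfields A"
  shows "curvature D X Y Z + curvature D Y Z X + curvature D Z X Y = 0"
proof -
  have *: "lie_bracket X (lie_bracket Y Z) = D X (D Y Z) - D X (D Z Y) - D (lie_bracket Y Z) X"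
    if "X \<in> vfields A" "Y \<in> vfields A" "Z \<in> vfields A" for X Y Z
  proof -
    have "lie_bracket X (lie_bracket Y Z) = D X (lie_bracket Y Z) - D (lie_bracket Y Z) X"
      using that by (simp add: torsion)
    also have "D X (lie_bracket Y Z) = D X (D Y Z) - D X (D Z Y)"
      using that by (simp add: torsion[symmetric] conn_diff_right)
    finally show ?thesis .
  qed
  show ?thesis
    using jacobi[OF XYZ] XYZ by (simp add: * curvature_def algebra_simps)
qed

text \<open>A tensorial change \<open>B\<close> leaves the Leibniz rule intact. The equation for
  \<open>D'\<close> is restricted to smooth fields because that of \<open>complex_conn\<close> is
  available only there.\<close>

lemma affine_connection_add_tensor:
  assumes eq: "\<And>X Y. X \<in> vfields A \<Longrightarrow> Y \<in> vfields A \<Longrightarrow> D' X Y = D X Y + B X Y"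
    and B: "\<And>X Y. X \<in> vfields A \<Longrightarrow> Y \<in> vfields A \<Longrightarrow> B X Y \<in> vfields A"
      "\<And>X Y Z. X \<in> vfields A \<Longrightarrow> Y \<in> vfields A \<Longrightarrow> Z \<in> vfields A \<Longrightarrow> B (X + Y) Z = B X Z + B Y Z"
      "\<And>f X Y. f \<in> Cinf A \<Longrightarrow> X \<in> vfields A \<Longrightarrow> Y \<in> vfields A \<Longrightarrow> B (f \<odot> X) Y = f \<odot> B X Y"
      "\<And>X Y Z. X \<in> vfields A \<Longrightarrow> Y \<in> vfields A \<Longrightarrow> Z \<in> vfields A \<Longrightarrow> B X (Y + Z) = B X Y + B X Z"
      "\<And>f X Y. f \<in> Cinf A \<Longrightarrow> X \<in> vfields A \<Longrightarrow> Y \<in> vfields A \<Longrightarrow> B X (f \<odot> Y) = f \<odot> B X Y"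
  shows "affine_connection A D'"
  unfolding affine_connection_def
proof (intro conjI ballI)
  fix f X Y assume *: "f \<in> Cinf A" "X \<in> vfields A" "Y \<in> vfields A"
  show "D' (f \<odot> X) Y = f \<odot> D' X Y" "D' X (f \<odot> Y) = act X f \<odot> Y + f \<odot> D' X Y"
    using * by (simp_all add: eq B conn_simps) (simp_all add: fscale_def fun_eq_iff algebra_simps)
qed (simp_all add: eq B conn_simps)

end

section \<open>Conformal Kaehler manifolds with Norden metric\<close>

locale conformal_norden =
  fixes A :: "('m::{t2_space,second_countable_topology}, 'e::euclidean_space) atlas"
    and n :: nat
    and J :: "'m vfield \<Rightarrow> 'm vfield"
    and g :: "'m vfield \<Rightarrow> 'm vfield \<Rightarrow> 'm \<Rightarrow> real"
    and D :: "'m vfield \<Rightarrow> 'm vfield \<Rightarrow> 'm vfield"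
    and \<theta> :: "'m vfield \<Rightarrow> 'm \<Rightarrow> real"
    and \<Omega> :: "'m vfield"
  assumes conformal: "conformal_kahler_norden A n J g D \<theta>"
    and lie_vector: "lie_vector A g \<theta> \<Omega>"
begin

lemma
  shows W1: "W1_manifold A n J g D \<theta>"
    and norden: "norden_manifold A n J g"
    and levi_civita: "levi_civita A g D"
    and closed_lie_form: "closed_one_form A \<theta>"
    and closed_lie_form_J: "closed_one_form A (\<theta> \<circ> J)"
  using conformal by (simp_all add: conformal_kahler_norden_def W1_manifold_def)

sublocale smooth_connection A D
  using norden levi_civita by unfold_locales (simp_all add: norden_manifold_def levi_civita_def)

section \<open>Algebra of \<open>J\<close>, \<open>g\<close> and the Lie form\<close>

lemma J_tensor: "tensor11 A J"
  using norden by (simp add: norden_manifold_def)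

lemma J_closed [simp]: "X \<in> vfields A \<Longrightarrow> J X \<in> vfields A"
  and J_add: "X \<in> vfields A \<Longrightarrow> Y \<in> vfields A \<Longrightarrow> J (X + Y) = J X + J Y"
  and J_fscale: "f \<in> Cinf A \<Longrightarrow> X \<in> vfields A \<Longrightarrow> J (f \<odot> X) = f \<odot> J X"
  and J_J: "X \<in> vfields A \<Longrightarrow> J (J X) = - X"
  using norden by (simp_all add: norden_manifold_def tensor11_def)

lemma J_uminus: "X \<in> vfields A \<Longrightarrow> J (- X) = - J X"
  by (simp add: uminus_eq_fscale J_fscale)

lemma J_diff: "X \<in> vfields A \<Longrightarrow> Y \<in> vfields A \<Longrightarrow> J (X - Y) = J X - J Y"
  using J_add[of X "- Y"] by (simp add: J_uminus)

lemmas J_simps = J_add J_fscale J_J J_uminus J_diff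

lemma g_tensor: "tensor02 A g"
  and g_sym: "X \<in> vfields A \<Longrightarrow> Y \<in> vfields A \<Longrightarrow> g X Y = g Y X"
  and g_JJ: "X \<in> vfields A \<Longrightarrow> Y \<in> vfields A \<Longrightarrow> g (J X) (J Y) = - g X Y"
  using norden by (simp_all add: norden_manifold_def pseudo_riemannian_def)

text \<open>The Norden condition is used at \<open>J X\<close> and \<open>Y\<close>, with
  \<open>J (J X) = - X\<close>. Thus \<open>J\<close> is self-adjoint, in contrast to the Hermitian
  case.\<close>

lemma g_J_left: "X \<in> vfields A \<Longrightarrow> Y \<in> vfields A \<Longrightarrow> g (J X) Y = g X (J Y)"
proof -
  assume *: "X \<in> vfields A" "Y \<in> vfields A"
  have "one_form A (g X)" if "X \<in> vfields A" for X
    using g_tensor that by (simp add: tensor02_def)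
  from one_form_uminus[OF this] show ?thesis
    using * g_JJ[of "J X" Y] by (simp add: J_J g_sym[of _ Y] g_sym[of _ "J Y"])
qed

lemma g_J_swap: "X \<in> vfields A \<Longrightarrow> Y \<in> vfields A \<Longrightarrow> g X (J Y) = g Y (J X)"
  using g_J_left[of X Y] g_sym[of "J X" Y] by simp

lemma g_form_right: "X \<in> vfields A \<Longrightarrow> one_form A (\<lambda>Y. g X Y)"
  and g_form_left: "X \<in> vfields A \<Longrightarrow> one_form A (\<lambda>Y. g Y X)"
  using g_tensor by (simp_all add: tensor02_def)

lemma theta_form: "one_form A \<theta>"
  using closed_lie_form by (simp add: closed_one_form_def)

lemma Omega_closed [simp]: "\<Omega> \<in> vfields A"
  and g_Omega_right: "X \<in> vfields A \<Longrightarrow> g X \<Omega> = \<theta> X"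
  using lie_vector by (simp_all add: lie_vector_def)

lemma g_Omega_left: "X \<in> vfields A \<Longrightarrow> g \<Omega> X = \<theta> X"
  using g_sym[of \<Omega> X] by (simp add: g_Omega_right)

lemma g_J_Omega: "X \<in> vfields A \<Longrightarrow> g X (J \<Omega>) = \<theta> (J X)"
  using g_J_left[of X \<Omega>] by (simp add: g_Omega_right)

lemma g_Cinf [simp]: "X \<in> vfields A \<Longrightarrow> Y \<in> vfields A \<Longrightarrow> g X Y \<in> Cinf A"
  by (simp add: one_form_Cinf[OF g_form_right])

lemma theta_Cinf [simp]: "X \<in> vfields A \<Longrightarrow> \<theta> X \<in> Cinf A"
  by (simp add: one_form_Cinf[OF theta_form])

lemmas form_simps =
  one_form_add[OF theta_form] one_form_fscale[OF theta_form] one_form_uminus[OF theta_form]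
  one_form_diff[OF theta_form]
  one_form_add[OF g_form_left] one_form_fscale[OF g_form_left] one_form_uminus[OF g_form_left]
  one_form_diff[OF g_form_left]
  one_form_add[OF g_form_right] one_form_fscale[OF g_form_right] one_form_uminus[OF g_form_right]
  one_form_diff[OF g_form_right]

text \<open>Nondegeneracy, applied at each point to \<open>X - Y\<close>, allows identities of
  vector fields to be checked after lowering the index.\<close>

lemma g_eqI:
  assumes "X \<in> vfields A" "Y \<in> vfields A" "\<And>Z. Z \<in> vfields A \<Longrightarrow> g X Z = g Y Z"
  shows "X = Y"
proof
  fix x
  have "\<forall>Z\<in>vfields A. g (X - Y) Z x = 0"
    using assms by (simp add: form_simps)
  then have "(X - Y) x = 0"
    using norden assms(1,2) vfields_diff unfolding norden_manifold_def pseudo_riemannian_def by blast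
  then show "X x = Y x" by simp
qed

text \<open>The factor \<open>1/2\<close> of the connection times the factor \<open>1 / (2n)\<close>
  of the \<open>W1\<close> condition.\<close>

definition k :: real where "k = 1 / (4 * real n)"

section \<open>Explicit forms of the derivative of \<open>J\<close> and of the complex
  connection\<close>

lemma cov_J_closed [simp]: "X \<in> vfields A \<Longrightarrow> Y \<in> vfields A \<Longrightarrow> cov_J D J X Y \<in> vfields A"
  by (simp add: cov_J_def)

text \<open>Paired with \<open>Z\<close>, the four fields on the right give the four terms of the
  \<open>W1\<close> condition, since \<open>\<Omega>\<close> represents \<open>\<theta>\<close> and
  \<open>J\<close> is self-adjoint.\<close>

lemma cov_J_eq:
  assumes "X \<in> vfields A" "Y \<in> vfields A"
  shows "cov_J D J X Y = const_fun (2 * k) \<odot>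
    (g X Y \<odot> \<Omega> + g X (J Y) \<odot> J \<Omega> + \<theta> Y \<odot> X + \<theta> (J Y) \<odot> J X)"
proof (rule g_eqI)
  fix Z assume Z: "Z \<in> vfields A"
  show "g (cov_J D J X Y) Z = g (const_fun (2 * k) \<odot>
    (g X Y \<odot> \<Omega> + g X (J Y) \<odot> J \<Omega> + \<theta> Y \<odot> X + \<theta> (J Y) \<odot> J X)) Z"
  proof
    fix x
    have "g (cov_J D J X Y) Z x = 1 / (2 * real n) *
            (g X Y x * \<theta> Z x + g X (J Y) x * \<theta> (J Z) x
             + g X Z x * \<theta> Y x + g X (J Z) x * \<theta> (J Y) x)"
      using W1 assms Z by (simp add: W1_manifold_def F_tensor_def)
    then show "g (cov_J D J X Y) Z x = g (const_fun (2 * k) \<odot>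
    (g X Y \<odot> \<Omega> + g X (J Y) \<odot> J \<Omega> + \<theta> Y \<odot> X + \<theta> (J Y) \<odot> J X)) Z x"
      using assms Z by (simp add: form_simps g_Omega_left g_J_left k_def algebra_simps)
  qed
qed (use assms in simp_all)

text \<open>Half of \<open>cov_J_eq\<close> at \<open>J Y\<close>, the minus signs coming from
  \<open>J (J Y) = - Y\<close>. The expanded form can be differentiated term by term.\<close>

definition Q :: "'m vfield \<Rightarrow> 'm vfield \<Rightarrow> 'm vfield" where
  "Q X Y = const_fun k \<odot> (g X (J Y) \<odot> \<Omega> - g X Y \<odot> J \<Omega> + \<theta> (J Y) \<odot> X - \<theta> Y \<odot> J X)"

lemma Q_closed [simp]: "X \<in> vfields A \<Longrightarrow> Y \<in> vfields A \<Longrightarrow> Q X Y \<in> vfields A"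
  by (simp add: Q_def)

lemma Q_tensor:
  "X \<in> vfields A \<Longrightarrow> Y \<in> vfields A \<Longrightarrow> Z \<in> vfields A \<Longrightarrow> Q (X + Y) Z = Q X Z + Q Y Z"
  "X \<in> vfields A \<Longrightarrow> Y \<in> vfields A \<Longrightarrow> Z \<in> vfields A \<Longrightarrow> Q (X - Y) Z = Q X Z - Q Y Z"
  "f \<in> Cinf A \<Longrightarrow> X \<in> vfields A \<Longrightarrow> Y \<in> vfields A \<Longrightarrow> Q (f \<odot> X) Y = f \<odot> Q X Y"
  "X \<in> vfields A \<Longrightarrow> Y \<in> vfields A \<Longrightarrow> Z \<in> vfields A \<Longrightarrow> Q X (Y + Z) = Q X Y + Q X Z"
  "f \<in> Cinf A \<Longrightarrow> X \<in> vfields A \<Longrightarrow> Y \<in> vfields A \<Longrightarrow> Q X (f \<odot> Y) = f \<odot> Q X Y"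
  by (simp_all add: Q_def form_simps J_simps) (simp_all add: fscale_def fun_eq_iff algebra_simps)

lemma Q_eq: "X \<in> vfields A \<Longrightarrow> Y \<in> vfields A \<Longrightarrow> (1/2) \<cdot>\<^sub>R cov_J D J X (J Y) = Q X Y"
  by (simp add: cov_J_eq Q_def J_simps form_simps)
    (simp add: rscale_def fscale_def fun_eq_iff algebra_simps)

definition \<eta> :: "real \<Rightarrow> real \<Rightarrow> 'm vfield \<Rightarrow> 'm \<Rightarrow> real" where
  "\<eta> a b X = const_fun a * \<theta> X + const_fun b * \<theta> (J X)"

lemma closed_eta: "closed_one_form A (\<eta> a b)"
proof -
  have "act X (\<eta> a b Y) - act Y (\<eta> a b X) - \<eta> a b (lie_bracket X Y) = 0"
    if "X \<in> vfields A" "Y \<in> vfields A" for X Y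
  proof -
    have "act X (\<theta> Y) - act Y (\<theta> X) - \<theta> (lie_bracket X Y) = 0"
      "act X (\<theta> (J Y)) - act Y (\<theta> (J X)) - \<theta> (J (lie_bracket X Y)) = 0"
      using closed_lie_form closed_lie_form_J that by (simp_all add: closed_one_form_def)
    then have "\<theta> (lie_bracket X Y) = act X (\<theta> Y) - act Y (\<theta> X)"
      "\<theta> (J (lie_bracket X Y)) = act X (\<theta> (J Y)) - act Y (\<theta> (J X))"
      by simp_all
    then show ?thesis
      using that by (simp add: \<eta>_def act_add act_mult act_const) (simp add: algebra_simps)
  qed
  moreover have "one_form A (\<eta> a b)"
    by (rule one_formI) (simp_all add: \<eta>_def form_simps J_simps algebra_simps)
  ultimately show ?thesis by (simp add: closed_one_form_def)
qed

lemma eta_form: "one_form A (\<eta> a b)"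
  using closed_eta by (simp add: closed_one_form_def)

text \<open>In both the \<open>p\<close> and the \<open>q\<close> bracket the
  \<open>\<Omega>\<close> and \<open>J \<Omega>\<close> terms cancel by the Norden condition, while
  the remaining terms double; hence the factor \<open>4 * k = 2 * (2 * k)\<close>.\<close>

lemma complex_conn_eq:
  assumes "X \<in> vfields A" "Y \<in> vfields A"
  shows "complex_conn J D p q X Y = D X Y + Q X Y + \<eta> (4 * k * p) (4 * k * q) X \<odot> Y
    + \<eta> (- 4 * k * q) (4 * k * p) X \<odot> J Y"
proof -
  have sym: "g Y X = g X Y" "g (J Y) X = g X (J Y)" "g Y (J X) = g X (J Y)" "g (J Y) (J X) = - g X Y"
    using assms g_sym[of X Y] g_JJ[of Y X] g_J_left[of Y X] g_sym[of X "J Y"] by simp_all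
  have "p \<cdot>\<^sub>R (cov_J D J Y X + cov_J D J (J Y) (J X)) =
      const_fun (4 * k * p) \<odot> (\<theta> X \<odot> Y + \<theta> (J X) \<odot> J Y)"
    using assms by (simp add: cov_J_eq J_simps form_simps sym)
      (simp add: rscale_def fscale_def fun_eq_iff algebra_simps)
  moreover have "q \<cdot>\<^sub>R (cov_J D J Y (J X) - cov_J D J (J Y) X) =
      const_fun (4 * k * q) \<odot> (\<theta> (J X) \<odot> Y - \<theta> X \<odot> J Y)"
    using assms by (simp add: cov_J_eq J_simps form_simps sym)
      (simp add: rscale_def fscale_def fun_eq_iff algebra_simps)
  ultimately show ?thesis
    using assms
    by (simp add: complex_conn_def Q_eq) (simp add: \<eta>_def fscale_def fun_eq_iff algebra_simps)
qed

section \<open>Connections preserving \<open>J\<close>, and elimination of \<open>p\<close> and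
  \<open>q\<close>\<close>

lemma affine_Q: "affine_connection A (\<lambda>X Y. D X Y + Q X Y)"
  by (rule affine_connection_add_tensor[where B=Q]) (simp_all add: Q_tensor)

lemma affine_complex_conn: "affine_connection A (complex_conn J D p q)"
  by (rule affine_connection_add_tensor[where B="\<lambda>X Y. Q X Y + \<eta> (4 * k * p) (4 * k * q) X \<odot> Y
    + \<eta> (- 4 * k * q) (4 * k * p) X \<odot> J Y"])
   (simp_all add: complex_conn_eq Q_tensor J_simps one_form_Cinf[OF eta_form] one_form_add[OF eta_form]
     one_form_fscale[OF eta_form], simp_all add: fscale_def fun_eq_iff algebra_simps)

text \<open>This is the covariant derivative of \<open>J (J Y) = - Y\<close>.\<close>

lemma cov_J_J:
  assumes "X \<in> vfields A" "Y \<in> vfields A"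
  shows "cov_J D J X (J Y) = - J (cov_J D J X Y)"
  using assms by (simp add: cov_J_def J_simps conn_simps)

lemma cov_J_uminus:
  assumes "X \<in> vfields A" "Y \<in> vfields A"
  shows "cov_J D J X (- Y) = - cov_J D J X Y"
  using assms by (simp add: cov_J_def J_simps conn_simps)

text \<open>\<open>D\<close> fails to commute with \<open>J\<close> by \<open>cov_J D J X Y\<close>;
  by \<open>cov_J_J\<close>, \<open>Q\<close> fails by exactly the opposite amount, one half from
  each side.\<close>

lemma Q_parallel:
  assumes "X \<in> vfields A" "Y \<in> vfields A"
  shows "D X (J Y) + Q X (J Y) = J (D X Y + Q X Y)"
proof -
  have "J (Q X Y) = (1/2) \<cdot>\<^sub>R cov_J D J X Y"
    unfolding Q_eq[OF assms, symmetric] rscale_eq_fscale using assms by (simp add: J_simps cov_J_J)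
  moreover have "Q X (J Y) = - ((1/2) \<cdot>\<^sub>R cov_J D J X Y)"
    using assms unfolding Q_eq[OF assms(1) J_closed[OF assms(2)], symmetric]
    by (simp add: J_J cov_J_uminus) (simp add: rscale_def fun_eq_iff)
  ultimately show ?thesis
    using assms by (simp add: J_add) (simp add: cov_J_def rscale_def fun_eq_iff field_simps)
qed

lemma complex_conn_parallel:
  assumes "X \<in> vfields A" "Y \<in> vfields A"
  shows "complex_conn J D p q X (J Y) = J (complex_conn J D p q X Y)"
  using assms Q_parallel[OF assms]
  by (simp add: complex_conn_eq J_simps one_form_Cinf[OF eta_form])

lemma curvature_complex_conn:
  assumes "X \<in> vfields A" "Y \<in> vfields A" "Z \<in> vfields A"
  shows "curvature (complex_conn J D p q) X Y Z = curvature (\<lambda>X Y. D X Y + Q X Y) X Y Z"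
proof -
  \<comment> \<open>The base connection here has to be \<open>D + Q\<close>, because
    \<open>D\<close> itself need not commute with \<open>J\<close>.\<close>
  interpret Q: smooth_connection A "\<lambda>X Y. D X Y + Q X Y"
    by unfold_locales (rule affine_Q)
  let ?D = "\<lambda>X Y. D X Y + Q X Y + \<eta> (4 * k * p) (4 * k * q) X \<odot> Y + \<eta> (- 4 * k * q) (4 * k * p) X \<odot> J Y"
  have "curvature (complex_conn J D p q) X Y Z = curvature ?D X Y Z"
    using assms
    by (intro curvature_cong[of "complex_conn J D p q" ?D] complex_conn_eq)
      (simp_all add: one_form_Cinf[OF eta_form])
  also have "\<dots> = curvature (\<lambda>X Y. D X Y + Q X Y) X Y Z"
    by (rule Q.curvature_add_closed_forms[where J = J and \<eta> = "\<eta> (4 * k * p) (4 * k * q)"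
          and \<zeta> = "\<eta> (- 4 * k * q) (4 * k * p)"])
      (use assms in \<open>auto intro: J_tensor J_J Q_parallel closed_eta\<close>)
  finally show ?thesis .
qed

section \<open>Covariant derivatives of the Lie form, the Lie vector and \<open>Q\<close>\<close>

lemma torsion: "X \<in> vfields A \<Longrightarrow> Y \<in> vfields A \<Longrightarrow> D X Y - D Y X = lie_bracket X Y"
  and metric: "X \<in> vfields A \<Longrightarrow> Y \<in> vfields A \<Longrightarrow> Z \<in> vfields A \<Longrightarrow>
    act X (g Y Z) = g (D X Y) Z + g Y (D X Z)"
  using levi_civita by (simp_all add: levi_civita_def)

abbreviation H :: "'m vfield \<Rightarrow> 'm vfield \<Rightarrow> 'm \<Rightarrow> real" where
  "H \<equiv> cov_form D \<theta>"

lemma act_theta: "X \<in> vfields A \<Longrightarrow> Y \<in> vfields A \<Longrightarrow> act X (\<theta> Y) = H X Y + \<theta> (D X Y)"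
  by (simp add: cov_form_def)

lemma H_Cinf [simp]: "X \<in> vfields A \<Longrightarrow> Y \<in> vfields A \<Longrightarrow> H X Y \<in> Cinf A"
  by (simp add: cov_form_def)

lemma H_uminus: "X \<in> vfields A \<Longrightarrow> Y \<in> vfields A \<Longrightarrow> H X (- Y) = - H X Y"
  by (simp add: cov_form_def conn_simps form_simps act_uminus)

lemma conn_J: "D X (J Y) = cov_J D J X Y + J (D X Y)"
  by (simp add: cov_J_def)

text \<open>Differentiating \<open>g Y \<Omega> = \<theta> Y\<close> with the metric connection
  shows that \<open>D X \<Omega>\<close> is dual to the derivative of
  \<open>\<theta>\<close>.\<close>

lemma g_conn_Omega: "X \<in> vfields A \<Longrightarrow> Y \<in> vfields A \<Longrightarrow> g (D X \<Omega>) Y = H X Y"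
  using metric[of X Y \<Omega>] by (simp add: g_Omega_right g_sym[of Y] cov_form_def)

lemma H_sym:
  assumes "X \<in> vfields A" "Y \<in> vfields A"
  shows "H X Y = H Y X"
proof -
  have "act X (\<theta> Y) - act Y (\<theta> X) - \<theta> (D X Y - D Y X) = 0"
    using closed_lie_form assms by (simp add: closed_one_form_def torsion)
  then have "H X Y - H Y X = 0"
    using assms by (simp add: act_theta form_simps)
  then show ?thesis by simp
qed

text \<open>Closedness of \<open>\<theta> \<circ> J\<close> makes
  \<open>H X (J Y) + \<theta> (cov_J D J X Y)\<close> symmetric, and by \<open>cov_J_eq\<close> the
  second summand is symmetric on its own.\<close>

lemma H_J_sym:
  assumes "X \<in> vfields A" "Y \<in> vfields A"
  shows "H X (J Y) = H Y (J X)"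
proof -
  have "act X (\<theta> (J Y)) x - act Y (\<theta> (J X)) x - \<theta> (J (D X Y - D Y X)) x = 0" for x
    using closed_lie_form_J assms by (simp add: closed_one_form_def torsion fun_eq_iff)
  then have "H X (J Y) + \<theta> (cov_J D J X Y) = H Y (J X) + \<theta> (cov_J D J Y X)"
    using assms by (simp add: act_theta conn_J form_simps J_simps)
      (simp add: fun_eq_iff algebra_simps)
  moreover have "\<theta> (cov_J D J X Y) = \<theta> (cov_J D J Y X)"
    using assms by (simp add: cov_J_eq form_simps g_sym[of Y X] g_J_left g_sym[of "J X" Y, symmetric])
      (simp add: fun_eq_iff algebra_simps)
  ultimately show ?thesis by simp
qed

text \<open>The covariant derivative of \<open>Q\<close>, obtained by the product rule. As
  \<open>g\<close> is parallel, derivatives fall only on \<open>J\<close>, \<open>\<theta>\<close>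
  and \<open>\<Omega>\<close>.\<close>

definition T :: "'m vfield \<Rightarrow> 'm vfield \<Rightarrow> 'm vfield \<Rightarrow> 'm vfield" where
  "T X Y Z = const_fun k \<odot> (g Y (cov_J D J X Z) \<odot> \<Omega> + g Y (J Z) \<odot> D X \<Omega>
    - g Y Z \<odot> (cov_J D J X \<Omega> + J (D X \<Omega>)) + (H X (J Z) + \<theta> (cov_J D J X Z)) \<odot> Y
    - H X Z \<odot> J Y - \<theta> Z \<odot> cov_J D J X Y)"

lemma conn_Q:
  assumes "X \<in> vfields A" "Y \<in> vfields A" "Z \<in> vfields A"
  shows "D X (Q Y Z) = Q (D X Y) Z + Q Y (D X Z) + T X Y Z"
  using assms
  by (simp add: Q_def T_def conn_simps act_theta metric conn_J form_simps act_const)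
    (simp add: fscale_def fun_eq_iff algebra_simps)

section \<open>The curvature formula and the Kaehler property\<close>

lemma curvature_Q:
  assumes "X \<in> vfields A" "Y \<in> vfields A" "Z \<in> vfields A"
  shows "curvature (\<lambda>X Y. D X Y + Q X Y) X Y Z
    = curvature D X Y Z + T X Y Z - T Y X Z + Q X (Q Y Z) - Q Y (Q X Z)"
  by (rule curvature_add_tensor[where Q = Q and T = T, OF torsion Q_closed Q_tensor(2) Q_tensor(4) conn_Q])
    (use assms in simp_all)

text \<open>The \<open>H\<close> terms of \<open>T\<close> give the derivative part of
  \<open>S\<close>. Its \<open>cov_J\<close> terms and the compositions of \<open>Q\<close> all
  carry \<open>k\<^sup>2\<close>; together they give the quadratic part of \<open>S\<close>, the
  \<open>P\<close> term and the terms in \<open>\<theta> \<Omega>\<close> and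
  \<open>\<theta> (J \<Omega>)\<close>.\<close>

lemma curvature_complex_conn_formula:
  assumes XYZW: "X \<in> vfields A" "Y \<in> vfields A" "Z \<in> vfields A" "W \<in> vfields A"
  shows "curvature04 g (complex_conn J D p q) X Y Z W x =
         curvature04 g D X Y Z W x
         - 1 / (4 * real n) * (psi1 g (S_tensor n J D \<theta>) X Y Z W x + psi2 J g (S_tensor n J D \<theta>) X Y Z W x)
         - 1 / (8 * (real n)\<^sup>2) * psi1 g (P_tensor J \<theta>) X Y Z W x
         - \<theta> \<Omega> x / (16 * (real n)\<^sup>2) * (3 * pi1 g X Y Z W x + pi2 J g X Y Z W x)
         + \<theta> (J \<Omega>) x / (16 * (real n)\<^sup>2) * pi3 J g X Y Z W x"
proof -
  \<comment> \<open>These put the arguments among \<open>X\<close>, \<open>Y\<close>,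
    \<open>Z\<close> into alphabetical order, so that equal products are recognised.\<close>
  note sym = g_sym[OF XYZW(2,1)] g_sym[OF XYZW(3,1)] g_sym[OF XYZW(3,2)]
    g_J_swap[OF XYZW(2,1)] g_J_swap[OF XYZW(3,1)] g_J_swap[OF XYZW(3,2)]
  have coeff: "1 / (4 * real n) = k" "1 / (8 * (real n)\<^sup>2) = 2 * k\<^sup>2"
    "u / (16 * (real n)\<^sup>2) = u * k\<^sup>2" for u
    by (simp_all add: k_def power2_eq_square)
  show ?thesis
    unfolding coeff S_tensor_def P_tensor_def psi1_def psi2_def pi1_def pi2_def pi3_def g_tilde_def
      curvature04_def curvature_complex_conn[OF XYZW(1-3)] curvature_Q[OF XYZW(1-3)]
    using XYZW
    by (simp add: T_def cov_J_eq Q_def form_simps J_simps H_uminus g_J_left sym g_conn_Omega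
        g_Omega_left g_Omega_right g_J_Omega)
      (simp add: field_simps power2_eq_square)
qed

text \<open>The first symmetry rests on closedness of \<open>\<theta> \<circ> J\<close>, the second
  on closedness of \<open>\<theta>\<close>. In the Bianchi sum they are needed for
  \<open>psi1\<close> and \<open>psi2\<close> respectively.\<close>

lemma S_tensor_sym:
  assumes "X \<in> vfields A" "Y \<in> vfields A"
  shows "S_tensor n J D \<theta> Y X x = S_tensor n J D \<theta> X Y x"
    and "S_tensor n J D \<theta> Y (J X) x = S_tensor n J D \<theta> X (J Y) x"
  using assms H_sym[OF assms] H_J_sym[OF assms]
  by (simp_all add: S_tensor_def J_J H_uminus form_simps)

lemma kahler_complex_conn: "kahler_tensor A J (curvature04 g (complex_conn J D p q))"
proof -
  interpret C: smooth_connection A "complex_conn J D p q"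
    by unfold_locales (rule affine_complex_conn)
  let ?R = "curvature04 g (complex_conn J D p q)"
  have commute: "curvature (complex_conn J D p q) X Y (J Z) = J (curvature (complex_conn J D p q) X Y Z)"
    if "X \<in> vfields A" "Y \<in> vfields A" "Z \<in> vfields A" for X Y Z
    by (rule C.curvature_commute) (simp_all add: that J_tensor complex_conn_parallel)
  have swap: "?R X Y Z W = - ?R Y X Z W"
    if "X \<in> vfields A" "Y \<in> vfields A" "Z \<in> vfields A" "W \<in> vfields A" for X Y Z W
    using that by (simp only: curvature04_def C.curvature_swap[of Y X Z] one_form_uminus[OF g_form_left]
        C.curvature_closed)
  have J_invariant: "?R X Y (J Z) (J W) = - ?R X Y Z W"
    if "X \<in> vfields A" "Y \<in> vfields A" "Z \<in> vfields A" "W \<in> vfields A" for X Y Z W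
    using that by (simp only: curvature04_def g_JJ commute C.curvature_closed)
  \<comment> \<open>\<open>complex_conn\<close> need not preserve \<open>g\<close>. So
    \<open>curvature04_skew\<close> is applied to \<open>D\<close>, and the correction terms of the
    formula are skew in \<open>Z\<close> and \<open>W\<close> by their shape.\<close>
  have skew: "?R X Y Z W = - ?R X Y W Z"
    if "X \<in> vfields A" "Y \<in> vfields A" "Z \<in> vfields A" "W \<in> vfields A" for X Y Z W
  proof
    fix x
    have "curvature04 g D X Y Z W = - curvature04 g D X Y W Z"
      by (rule curvature04_skew) (use that in \<open>simp_all add: g_tensor g_sym metric\<close>)
    then have "curvature04 g D X Y Z W x = - curvature04 g D X Y W Z x" by simp
    then show "?R X Y Z W x = (- ?R X Y W Z) x"
      using that
      by (simp add: curvature_complex_conn_formula psi1_def psi2_def pi1_def pi2_def pi3_def algebra_simps)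
  qed
  \<comment> \<open>\<open>complex_conn\<close> may have torsion, so the identity is taken from
    \<open>D\<close> and the correction terms are summed cyclically.\<close>
  have bianchi: "?R X Y Z W + ?R Y Z X W + ?R Z X Y W = 0"
    if XYZW: "X \<in> vfields A" "Y \<in> vfields A" "Z \<in> vfields A" "W \<in> vfields A" for X Y Z W
  proof
    fix x
    have "curvature D X Y Z + curvature D Y Z X + curvature D Z X Y = 0"
      by (rule first_bianchi) (simp_all add: that torsion)
    then have "g (curvature D X Y Z + curvature D Y Z X + curvature D Z X Y) W = g 0 W" by simp
    \<comment> \<open>The zero field is written as a multiple of \<open>W\<close> to obtain
      \<open>g 0 W = 0\<close> from linearity over functions.\<close>
    moreover have "g (0 \<odot> W) W = 0"
      using XYZW by (simp add: form_simps)
    then have "g 0 W = 0" by (simp add: fscale_def zero_fun_def)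
    ultimately have R: "curvature04 g D X Y Z W x + curvature04 g D Y Z X W x + curvature04 g D Z X Y W x = 0"
      using that by (simp add: curvature04_def form_simps fun_eq_iff)
    note sym = g_sym[OF XYZW(2,1)] g_sym[OF XYZW(3,1)] g_sym[OF XYZW(3,2)]
      g_J_swap[OF XYZW(2,1)] g_J_swap[OF XYZW(3,1)] g_J_swap[OF XYZW(3,2)]
    note S_sym = S_tensor_sym[OF XYZW(1,2)] S_tensor_sym[OF XYZW(1,3)] S_tensor_sym[OF XYZW(2,3)]
    show "(?R X Y Z W + ?R Y Z X W + ?R Z X Y W) x = 0 x"
      using that R
      by (simp add: curvature_complex_conn_formula psi1_def psi2_def pi1_def pi2_def pi3_def
          P_tensor_def g_tilde_def sym S_sym)
        (simp add: algebra_simps add_divide_distrib diff_divide_distrib)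
  qed
  show ?thesis
    unfolding kahler_tensor_def curvature_like_def
    by (intro conjI ballI C.curvature04_tensor g_tensor swap skew bianchi J_invariant)
qed

end

theorem theorem3p1:
  fixes A :: "('m::{t2_space,second_countable_topology}, 'e::euclidean_space) atlas"
    and n :: nat
    and J :: "'m vfield \<Rightarrow> 'm vfield"
    and g :: "'m vfield \<Rightarrow> 'm vfield \<Rightarrow> 'm \<Rightarrow> real"
    and D :: "'m vfield \<Rightarrow> 'm vfield \<Rightarrow> 'm vfield"
    and \<theta> :: "'m vfield \<Rightarrow> 'm \<Rightarrow> real"
    and \<Omega> :: "'m vfield"
    and p q :: real
  assumes "conformal_kahler_norden A n J g D \<theta>"
    and "lie_vector A g \<theta> \<Omega>"
  shows "kahler_tensor A J (curvature04 g (complex_conn J D p q)) \<and>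
    (\<forall>X\<in>vfields A. \<forall>Y\<in>vfields A. \<forall>Z\<in>vfields A. \<forall>W\<in>vfields A. \<forall>x.
       curvature04 g (complex_conn J D p q) X Y Z W x =
         curvature04 g D X Y Z W x
         - 1 / (4 * real n) * (psi1 g (S_tensor n J D \<theta>) X Y Z W x + psi2 J g (S_tensor n J D \<theta>) X Y Z W x)
         - 1 / (8 * (real n)\<^sup>2) * psi1 g (P_tensor J \<theta>) X Y Z W x
         - \<theta> \<Omega> x / (16 * (real n)\<^sup>2) * (3 * pi1 g X Y Z W x + pi2 J g X Y Z W x)
         + \<theta> (J \<Omega>) x / (16 * (real n)\<^sup>2) * pi3 J g X Y Z W x)"
proof -
  interpret conformal_norden A n J g D \<theta> \<Omega>
    using assms by unfold_locales
  show ?thesis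
    using kahler_complex_conn curvature_complex_conn_formula by blast
qed

end
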